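(* Let $c\in(0,1)$, $d\in\{1,2,\ldots\}$, let $\alpha>1$ be non-integer, and let $L$ be a positive slowly varying function. Let $T$ be a nonnegative random variable with $\mathbb{E}T=d$, let $N(t)$, $t\ge 0$, be a Poisson process of rate $1$ independent of $T$, and let $R$ be a nonnegative random variable with $\mathbb{E}R=1$ satisfying the distributional identity $$R\stackrel{d}{=}c\sum_{j=1}^{N(T)}\frac{1}{d}R_{j}+(1-c),$$ where $R_1,R_2,\ldots$ are independent, distributed as $R$, and independent of $N(T)$. Then the following are equivalent: (i) $\bar F_{N(T)}(x)\sim x^{-\alpha}L(x)$ as $x\to\infty$; (ii) $\bar F_{R}(x)\sim \dfrac{c^{\alpha}}{d^{\alpha}-c^{\alpha}d}\,x^{-\alpha}L(x)$ as $x\to\infty$.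
   Context: For a random variable $X$ with distribution function $F_X$, write $\bar F_X(x)=1-F_X(x)$. The notation $a(x)\sim b(x)$ means $a(x)/b(x)\to 1$. A function $L$ is slowly varying if $L(tx)/L(x)\to 1$ as $x\to\infty$ for every $t>0$. $N(T)$ denotes the number of arrivals of the Poisson process in the random time interval $[0,T]$. Here $N(T)$ models the In-Degree of a random Web page, $d$ the (constant) Out-Degree, $c$ the damping factor, and $R$ the PageRank of a random page. The symbol $\stackrel{d}{=}$ denotes equality in distribution. *)

theory Defs
  imports "HOL-Probability.Probability" "HOL-Library.Landau_Symbols"
begin

definition slowly_varying :: "(real \<Rightarrow> real) \<Rightarrow> bool" where
  "slowly_varying L \<longleftrightarrow> (\<forall>t>0. ((\<lambda>x. L (t * x) / L x) \<longlongrightarrow> 1) at_top)"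

definition tail_df :: "'a measure \<Rightarrow> ('a \<Rightarrow> real) \<Rightarrow> real \<Rightarrow> real" where
  "tail_df M X x = 1 - cdf (distr M borel X) x"

(* prob_space.indep_var requires both variables to have the same codomain type.  This version
   allows different ones, which is needed for a variable versus a whole sequence or process. *)
definition indep_rv ::
    "'a measure \<Rightarrow> 'b measure \<Rightarrow> ('a \<Rightarrow> 'b) \<Rightarrow> 'c measure \<Rightarrow> ('a \<Rightarrow> 'c) \<Rightarrow> bool" where
  "indep_rv M A X B Y \<longleftrightarrow>
     X \<in> measurable M A \<and> Y \<in> measurable M B \<and>
     prob_space.indep_set M (sets (vimage_algebra (space M) X A))
                            (sets (vimage_algebra (space M) Y B))"

(* N t \<omega> is the number of arrivals in [0,t]; values at negative t are irrelevant.  The path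
   properties hold for every \<omega>, not just almost surely: monotonicity makes the nat subtractions
   below genuine increments, and right-continuity makes the count at a random time measurable. *)
definition poisson_process :: "'a measure \<Rightarrow> real \<Rightarrow> (real \<Rightarrow> 'a \<Rightarrow> nat) \<Rightarrow> bool" where
  "poisson_process M rate N \<longleftrightarrow>
     0 < rate \<and>
     (\<forall>t\<ge>0. N t \<in> measurable M (count_space UNIV)) \<and>
     (\<forall>\<omega>\<in>space M. N 0 \<omega> = 0 \<and> mono_on {0..} (\<lambda>t. N t \<omega>) \<and>
        (\<forall>t\<ge>0. ((\<lambda>s. N s \<omega>) \<longlongrightarrow> N t \<omega>) (at_right t))) \<and>
     (\<forall>(n::nat) \<tau>. 0 \<le> \<tau> 0 \<and> (\<forall>i<n. \<tau> i \<le> \<tau> (Suc i)) \<longrightarrow>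
        prob_space.indep_vars M (\<lambda>_. count_space UNIV)
          (\<lambda>i \<omega>. N (\<tau> (Suc i)) \<omega> - N (\<tau> i) \<omega>) {..<n}) \<and>
     (\<forall>s t. 0 \<le> s \<and> s < t \<longrightarrow>
        distr M (count_space UNIV) (\<lambda>\<omega>. N t \<omega> - N s \<omega>)
          = measure_pmf (poisson_pmf (rate * (t - s))))"

end

theory Submission
  imports Defs "HOL-Real_Asymp.Real_Asymp"
begin

text \<open>
  Put \<open>a = c / d\<close>, \<open>K = N(T)\<close> and \<open>S k = R\<^sub>1 + \<dots> + R\<^sub>k\<close>, so that \<open>R\<close> is distributed as
  \<open>a * S K + (1 - c)\<close>.  Taking expectations gives \<open>E K = d\<close>.  The reason for the equivalence is the
  principle of one big jump: \<open>S K\<close> exceeds a large \<open>x\<close> essentially either because \<open>K\<close> itself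
  exceeds \<open>x\<close> (the law of large numbers then makes \<open>S K\<close> close to \<open>K\<close>, as \<open>E R = 1\<close>), or because
  \<open>K\<close> is moderate and one of the \<open>K\<close> summands exceeds \<open>x\<close>.  Hence
  \<open>P (R > a * x) \<approx> P (K > x) + d * P (R > x)\<close>.  If one of the two tails is regularly varying with index
  \<open>- \<alpha>\<close>, then inserting \<open>P (R > a * x) \<approx> a powr - \<alpha> * P (R > x)\<close> yields
  \<open>P (K > x) \<approx> (a powr - \<alpha> - d) * P (R > x)\<close>, which is the asserted constant, because
  \<open>1 / (a powr - \<alpha> - d) = c powr \<alpha> / (d powr \<alpha> - c powr \<alpha> * d)\<close>.

  The displayed heuristic becomes two inequalities, \<open>tail_R_lower\<close> and \<open>tail_R_upper\<close>, up to an
  arbitrarily small relative error and an arbitrarily small change of scale.  The upper one needs a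
  bound for \<open>P (S k > x)\<close> that is uniform in \<open>k \<le> x\<close>; this is \<open>tail_S_le_jumps\<close>, an exponential
  (Fuk-Nagaev) estimate for sums truncated at a small multiple of \<open>x\<close>.  It requires a moment of \<open>R\<close>
  of some order \<open>p > 1\<close>.  If the tail of \<open>R\<close> is regularly varying, such a moment is immediate from
  \<open>\<alpha> > 1\<close>; if the tail of \<open>K\<close> is, the moment of \<open>K\<close> is transferred to \<open>R\<close> by
  \<open>R_moment_of_K_moment\<close>, where \<open>a * E K = c < 1\<close> makes the recursion for the moments contractive.

  If the tail of \<open>R\<close> is regularly varying, dividing the two inequalities by \<open>P (R > x)\<close> gives
  the limit at once (\<open>ratio_of_regular_tail_R\<close>).  If the tail of \<open>K\<close> is, nothing is known in advance
  about \<open>P (R > x)\<close>, and two steps are needed.  First, \<open>P (R > x) / P (K > x)\<close> is bounded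
  (\<open>tail_R_dominated_by_tail_K\<close>), by iterating a coarser inequality along \<open>x, x / a, x / a\<^sup>2, \<dots>\<close> in the
  form of a weighted supremum bound.  Secondly, the upper and lower limits of the quotient are
  compared with the fixed point of \<open>u \<mapsto> a powr \<alpha> * (1 + d * u)\<close>, whose slope
  \<open>d * a powr \<alpha>\<close> is less than 1 (\<open>ratio_of_regular_tail_K\<close>).
\<close>

section \<open>Regularly varying tails\<close>

text \<open>
  Regular variation of index \<open>- \<alpha>\<close>, stated for the tail itself.  A slowly
  varying function may be irregular, even not measurable, whereas a tail is monotone; therefore all
  estimates are made on tails.
\<close>

definition regular_tail :: "real \<Rightarrow> (real \<Rightarrow> real) \<Rightarrow> bool" where
  "regular_tail \<alpha> W \<longleftrightarrow> antimono W \<and> (\<forall>x. 0 < W x) \<and>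
     (\<forall>t>0. ((\<lambda>x. W (t * x) / W x) \<longlongrightarrow> t powr (- \<alpha>)) at_top)"

lemma regular_tailD:
  assumes "regular_tail \<alpha> W"
  shows "x \<le> y \<Longrightarrow> W y \<le> W x" "0 < W x"
    "0 < t \<Longrightarrow> ((\<lambda>x. W (t * x) / W x) \<longlongrightarrow> t powr (- \<alpha>)) at_top"
  using assms by (auto simp: regular_tail_def antimono_def)

lemma regular_tail_scale_less:
  assumes "regular_tail \<alpha> W" "0 < t" "t powr (- \<alpha>) < m"
  shows "\<forall>\<^sub>F x in at_top. W (t * x) \<le> m * W x"
proof -
  have "\<forall>\<^sub>F x in at_top. W (t * x) / W x < m"
    using order_tendstoD(2)[OF regular_tailD(3)[OF assms(1,2)] assms(3)] .
  then show ?thesis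
    by eventually_elim (use regular_tailD(2)[OF assms(1)] in \<open>simp add: divide_simps less_imp_le\<close>)
qed

lemma regular_tail_scale_greater:
  assumes "regular_tail \<alpha> W" "0 < t" "m < t powr (- \<alpha>)"
  shows "\<forall>\<^sub>F x in at_top. m * W x \<le> W (t * x)"
proof -
  have "\<forall>\<^sub>F x in at_top. m < W (t * x) / W x"
    using order_tendstoD(1)[OF regular_tailD(3)[OF assms(1,2)] assms(3)] .
  then show ?thesis
    by eventually_elim (use regular_tailD(2)[OF assms(1)] in \<open>simp add: divide_simps less_imp_le\<close>)
qed

lemma eventually_at_top_scale:
  fixes P :: "real \<Rightarrow> bool"
  assumes "0 < l" "\<forall>\<^sub>F x in at_top. P (l * x)"
  shows "\<forall>\<^sub>F x in at_top. P x"
proof -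
  obtain N where N: "\<And>x. x \<ge> N \<Longrightarrow> P (l * x)" using assms(2) by (auto simp: eventually_at_top_linorder)
  have "P y" if "y \<ge> l * N" for y
    using N[of "y / l"] that assms(1) by (simp add: field_simps)
  then show ?thesis by (auto simp: eventually_at_top_linorder)
qed

lemma eventually_scale_at_top:
  fixes P :: "real \<Rightarrow> bool"
  assumes "0 < l" "\<forall>\<^sub>F x in at_top. P x"
  shows "\<forall>\<^sub>F x in at_top. P (l * x)"
  by (rule eventually_compose_filterlim[OF assms(2)])
     (rule filterlim_tendsto_pos_mult_at_top[OF tendsto_const assms(1) filterlim_ident])

lemma dyadic_interval:
  fixes y :: real
  assumes "1 \<le> y"
  obtains n :: nat where "2 ^ n \<le> y" "y < 2 ^ Suc n"
proof -
  define n where "n = nat \<lfloor>log 2 y\<rfloor>"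
  have "0 \<le> log 2 y" using assms by simp
  then have n: "real n \<le> log 2 y" "log 2 y < real (Suc n)"
    unfolding n_def by linarith+
  then have "2 powr real n \<le> y" "y < 2 powr real (Suc n)"
    using assms by (auto simp: le_log_iff log_less_iff)
  then show ?thesis using that[of n] by (simp only: powr_realpow zero_less_numeral)
qed

text \<open>
  Every doubling of the argument multiplies \<open>W\<close> by about \<open>2 powr - \<alpha>\<close>, and monotonicity fills
  the gaps between consecutive points \<open>2 ^ n * x0\<close>.  Thus \<open>W\<close> lies between any two powers
  whose exponents enclose \<open>- \<alpha>\<close>, a weak form of Potter's bounds.
\<close>

lemma regular_tail_ge_power:
  assumes W: "regular_tail \<alpha> W" and "\<alpha> < \<beta>" "0 < \<beta>"
  shows "\<exists>C>0. \<forall>\<^sub>F x in at_top. C * x powr (- \<beta>) \<le> W x"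
proof -
  have "\<forall>\<^sub>F x in at_top. 2 powr (- \<beta>) * W x \<le> W (2 * x)"
    using regular_tail_scale_greater[OF W] assms(2) by simp
  then obtain x1 where x1: "\<And>x. x \<ge> x1 \<Longrightarrow> 2 powr (- \<beta>) * W x \<le> W (2 * x)"
    by (auto simp: eventually_at_top_linorder)
  define x0 where "x0 = max x1 1"
  have x0: "x0 > 0" "x1 \<le> x0" by (auto simp: x0_def)
  have iter: "2 powr (- \<beta> * real n) * W x0 \<le> W (2 ^ n * x0)" for n
  proof (induction n)
    case (Suc n)
    have "1 * x0 \<le> 2 ^ n * x0" using x0 by (intro mult_right_mono) auto
    then have ge: "2 ^ n * x0 \<ge> x1" using x0 by linarith
    have "2 powr (- \<beta> * real (Suc n)) * W x0 = 2 powr (- \<beta>) * (2 powr (- \<beta> * real n) * W x0)"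
      by (simp add: powr_add[symmetric] algebra_simps)
    also have "\<dots> \<le> 2 powr (- \<beta>) * W (2 ^ n * x0)" using Suc by (intro mult_left_mono) auto
    also have "\<dots> \<le> W (2 * (2 ^ n * x0))" by (rule x1[OF ge])
    finally show ?case by (simp add: mult.assoc)
  qed auto
  define C where "C = (2 / x0) powr (- \<beta>) * W x0"
  have "C * x powr (- \<beta>) \<le> W x" if "x \<ge> x0" for x
  proof -
    have "1 \<le> x / x0" using that x0 by simp
    then obtain n where n: "2 ^ n \<le> x / x0" "x / x0 < 2 ^ Suc n" by (rule dyadic_interval)
    have "(2 / x0 * x) powr (- \<beta>) \<le> (2 ^ Suc n) powr (- \<beta>)"
      using n x0 that assms(3) by (intro powr_mono2') (auto simp: field_simps)
    also have "\<dots> = 2 powr (- \<beta> * real (Suc n))"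
      by (metis mult.commute powr_powr powr_realpow zero_less_numeral)
    finally have "(2 / x0 * x) powr (- \<beta>) * W x0 \<le> 2 powr (- \<beta> * real (Suc n)) * W x0"
      using regular_tailD(2)[OF W] by (intro mult_right_mono) (auto simp: less_imp_le)
    also have "\<dots> \<le> W (2 ^ Suc n * x0)" by (rule iter)
    also have "\<dots> \<le> W x" using n x0 by (intro regular_tailD(1)[OF W]) (auto simp: field_simps)
    finally show ?thesis using x0 that powr_mult[of "2 / x0" x "- \<beta>"] by (simp add: C_def mult.commute mult.left_commute)
  qed
  moreover have "C > 0" using x0 regular_tailD(2)[OF W] by (simp add: C_def)
  ultimately show ?thesis by (auto simp: eventually_at_top_linorder)
qed

lemma regular_tail_le_power:
  assumes W: "regular_tail \<alpha> W" and "p < \<alpha>" "0 < p"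
  shows "\<exists>C>0. \<forall>\<^sub>F x in at_top. W x \<le> C * x powr (- p)"
proof -
  have "\<forall>\<^sub>F x in at_top. W (2 * x) \<le> 2 powr (- p) * W x"
    using regular_tail_scale_less[OF W] assms(2) by simp
  then obtain x1 where x1: "\<And>x. x \<ge> x1 \<Longrightarrow> W (2 * x) \<le> 2 powr (- p) * W x"
    by (auto simp: eventually_at_top_linorder)
  define x0 where "x0 = max x1 1"
  have x0: "x0 > 0" "x1 \<le> x0" by (auto simp: x0_def)
  have iter: "W (2 ^ n * x0) \<le> 2 powr (- p * real n) * W x0" for n
  proof (induction n)
    case (Suc n)
    have "1 * x0 \<le> 2 ^ n * x0" using x0 by (intro mult_right_mono) auto
    then have ge: "2 ^ n * x0 \<ge> x1" using x0 by linarith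
    have "W (2 * (2 ^ n * x0)) \<le> 2 powr (- p) * W (2 ^ n * x0)" by (rule x1[OF ge])
    also have "\<dots> \<le> 2 powr (- p) * (2 powr (- p * real n) * W x0)" using Suc by (intro mult_left_mono) auto
    also have "\<dots> = 2 powr (- p * real (Suc n)) * W x0"
      by (simp add: powr_add[symmetric] algebra_simps)
    finally show ?case by (simp add: mult.assoc)
  qed auto
  define C where "C = (1 / (2 * x0)) powr (- p) * W x0"
  have "W x \<le> C * x powr (- p)" if "x \<ge> x0" for x
  proof -
    have "1 \<le> x / x0" using that x0 by simp
    then obtain n where n: "2 ^ n \<le> x / x0" "x / x0 < 2 ^ Suc n" by (rule dyadic_interval)
    have "W x \<le> W (2 ^ n * x0)" using n x0 by (intro regular_tailD(1)[OF W]) (auto simp: field_simps)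
    also have "\<dots> \<le> 2 powr (- p * real n) * W x0" by (rule iter)
    also have "2 powr (- p * real n) = (2 ^ n) powr (- p)"
      by (metis mult.commute powr_powr powr_realpow zero_less_numeral)
    also have "\<dots> \<le> (1 / (2 * x0) * x) powr (- p)"
      using n x0 that assms(3) by (intro powr_mono2') (auto simp: field_simps)
    finally show ?thesis using x0 that regular_tailD(2)[OF W, of x0] powr_mult[of "1 / (2 * x0)" x "- p"]
      by (simp add: C_def mult.commute mult.left_commute)
  qed
  moreover have "C > 0" using x0 regular_tailD(2)[OF W] by (simp add: C_def)
  ultimately show ?thesis by (auto simp: eventually_at_top_linorder)
qed

text \<open>
  A recursive inequality of this form runs from \<open>y\<close> to the larger point \<open>y / r\<close>, so it cannot be
  iterated from a starting value.  Instead, \<open>q\<close> is measured against the weights \<open>V y + l / y\<close>.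
  The summand \<open>l / y\<close> makes the supremum of the quotient finite beforehand.  Passing from \<open>y\<close>
  to \<open>y / r\<close> reduces both summands at least by the factor \<open>r\<close> (for \<open>V\<close> because \<open>\<alpha> > 1\<close>),
  and \<open>d * r < 1\<close>, so the inequality bounds the supremum independently of \<open>l\<close>; then \<open>l \<rightarrow> 0\<close>.
\<close>

lemma tail_domination:
  fixes q V :: "real \<Rightarrow> real"
  assumes V: "regular_tail \<alpha> V" and "1 < \<alpha>"
    and q: "\<And>y. 0 \<le> q y" "\<And>y. q y \<le> 1" "\<And>y. y > 0 \<Longrightarrow> y * q y \<le> 1"
    and r: "0 < r" "r < 1" "0 \<le> d" "d * r < 1" and e: "0 < e" and C: "0 \<le> C"
    and rec: "\<And>\<theta>. \<theta> > 0 \<Longrightarrow> \<forall>\<^sub>F y in at_top. q y \<le> C * V y + d * q (y / r) + \<theta> * q (e * y)"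
  shows "\<exists>D>0. \<forall>\<^sub>F y in at_top. q y \<le> D * V y"
proof -
  define D1 where "D1 = max (1 / e) (e powr (- \<alpha>) + 1)"
  have D1: "D1 > 0" "1 / e \<le> D1" using e by (auto simp: D1_def less_max_iff_disj)
  have ev1: "\<forall>\<^sub>F y in at_top. V (e * y) \<le> D1 * V y"
    by (intro regular_tail_scale_less[OF V e]) (auto simp: D1_def)
  have "r powr \<alpha> < r powr 1" using r assms(2) by (intro powr_less_mono') auto
  then have "(1 / r) powr (- \<alpha>) < r" using r by (simp add: powr_divide powr_minus divide_simps)
  then have ev2: "\<forall>\<^sub>F y in at_top. V (1 / r * y) \<le> r * V y"
    using r by (intro regular_tail_scale_less[OF V]) auto
  define \<theta> where "\<theta> = (1 - d * r) / (2 * D1)"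
  have \<theta>: "\<theta> > 0" using r D1 by (simp add: \<theta>_def)
  have "\<forall>\<^sub>F y in at_top. V (e * y) \<le> D1 * V y \<and> V (1 / r * y) \<le> r * V y
          \<and> q y \<le> C * V y + d * q (y / r) + \<theta> * q (e * y)"
    using ev1 ev2 rec[OF \<theta>] by eventually_elim auto
  then obtain x0 where x0: "\<And>y. y \<ge> x0 \<Longrightarrow> V (e * y) \<le> D1 * V y \<and> V (1 / r * y) \<le> r * V y
          \<and> q y \<le> C * V y + d * q (y / r) + \<theta> * q (e * y)"
    by (auto simp: eventually_at_top_linorder)
  define x1 where "x1 = max x0 1"
  define x2 where "x2 = max x1 (x1 / e)"
  have x1: "x1 > 0" "x0 \<le> x1" by (auto simp: x1_def)
  define D where "D = max (1 / V x2) (2 * C / (1 - d * r))"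
  have Vpos: "V y > 0" for y using regular_tailD(2)[OF V] .
  have D: "D > 0" using Vpos by (simp add: D_def less_max_iff_disj)
  have weighted: "q y \<le> D * (V y + l / y)" if l: "l > 0" and y: "y \<ge> x1" for l y
  proof -
    define W where "W y = V y + l / y" for y
    have Wpos: "W y > 0" if "y > 0" for y unfolding W_def using that Vpos[of y] l by (auto intro: add_pos_pos)
    \<comment> \<open>finite because \<open>q y \<le> 1 / y\<close>\<close>
    define N where "N = (SUP y\<in>{x1..}. q y / W y)"
    have bound: "q y / W y \<le> 1 / l" if "y \<ge> x1" for y
    proof -
      have y: "y > 0" using that x1 by simp
      have "q y \<le> 1 / y" using q(3)[OF y] y by (simp add: field_simps)
      also have "\<dots> \<le> W y / l" using y l Vpos[of y] by (simp add: W_def field_simps)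
      finally show ?thesis using Wpos[OF y] l by (simp add: field_simps)
    qed
    have bdd: "bdd_above ((\<lambda>y. q y / W y) ` {x1..})" using bound by (auto intro!: bdd_aboveI[of _ "1/l"])
    have N: "q y \<le> N * W y" if "y \<ge> x1" for y
    proof -
      have "q y / W y \<le> N" unfolding N_def using that by (intro cSUP_upper bdd) auto
      then show ?thesis using Wpos[of y] that x1 by (simp add: field_simps)
    qed
    have "0 \<le> q x1 / W x1" using q(1) Wpos[of x1] x1 by simp
    also have "\<dots> \<le> N" unfolding N_def by (intro cSUP_upper bdd) auto
    finally have N0: "N \<ge> 0" .
    have step: "q y / W y \<le> max (1 / V x2) (C + (1 + d * r) / 2 * N)" if y: "y \<ge> x1" for y
    proof (cases "y \<le> x2")
      case True
      have "V x2 \<le> W y" using regular_tailD(1)[OF V True] l y x1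
        by (simp add: W_def add_increasing2)
      then have "q y / W y \<le> 1 / V x2"
        using q(1,2)[of y] Vpos[of x2] by (intro frac_le) auto
      then show ?thesis by simp
    next
      case False
      have y0: "y > 0" using y x1 by simp
      have ey: "e * y \<ge> x1" 
      proof -
        have "x1 / e \<le> x2" by (simp add: x2_def)
        then have "x1 / e \<le> y" using False by simp
        then show ?thesis using e by (simp add: pos_divide_le_eq mult.commute)
      qed
      have yr: "y / r \<ge> x1" using r y y0 
        by (smt (verit) divide_less_eq_1_pos le_divide_eq_1_pos mult_imp_le_div_pos mult_le_cancel_left2)
      have f: "V (e * y) \<le> D1 * V y" "V (1 / r * y) \<le> r * V y"
        "q y \<le> C * V y + d * q (y / r) + \<theta> * q (e * y)" using x0[of y] y x1 by auto
      have 1: "W (y / r) \<le> r * W y" using f(2) r y0 by (simp add: W_def algebra_simps)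
      have "l / (e * y) \<le> D1 * (l / y)"
        using D1 l y0 mult_right_mono[OF D1(2), of "l / y"] by simp
      then have 2: "W (e * y) \<le> D1 * W y" using f(1) by (simp add: W_def algebra_simps)
      have "q y \<le> C * W y + d * (N * W (y / r)) + \<theta> * (N * W (e * y))"
        using f(3) N[OF yr] N[OF ey] r(3) \<theta> C l y0
        by (smt (verit) W_def mult_left_mono divide_pos_pos)
      also have "\<dots> \<le> C * W y + d * (N * (r * W y)) + \<theta> * (N * (D1 * W y))"
        using 1 2 r(3) \<theta> N0 by (intro add_mono mult_left_mono order_refl) auto
      also have "\<dots> = (C + (d * r + \<theta> * D1) * N) * W y" by (simp add: algebra_simps)
      also have "d * r + \<theta> * D1 = (1 + d * r) / 2" using D1 by (simp add: \<theta>_def field_simps)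
      finally have "q y / W y \<le> C + (1 + d * r) / 2 * N" using Wpos[OF y0] by (simp add: field_simps)
      then show ?thesis by simp
    qed
    have Nle: "N \<le> max (1 / V x2) (C + (1 + d * r) / 2 * N)"
      by (subst N_def, rule cSUP_least) (use step in auto)
    have "N \<le> D"
    proof (cases "N \<le> 1 / V x2")
      case False
      then have "N \<le> C + (1 + d * r) / 2 * N" using Nle by auto
      then have "N * (1 - d * r) \<le> 2 * C" by (simp add: field_simps)
      then have "N \<le> 2 * C / (1 - d * r)" using r by (simp add: field_simps)
      then show ?thesis by (simp add: D_def)
    qed (simp add: D_def)
    then have "q y \<le> D * W y" using N[OF y] Wpos[of y] y x1
      by (meson less_imp_le mult_right_mono order_trans less_le_trans)
    then show ?thesis by (simp add: W_def)
  qed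
  have "q y \<le> D * V y" if y: "y \<ge> x1" for y
  proof (rule field_le_epsilon)
    fix e' :: real assume "e' > 0"
    then have "q y \<le> D * (V y + (e' * y / D) / y)" using D y x1 by (intro weighted) auto
    also have "\<dots> = D * V y + e'" using D y x1 by (simp add: field_simps)
    finally show "q y \<le> D * V y + e'" .
  qed
  then show ?thesis using D by (auto simp: eventually_at_top_linorder)
qed

text \<open>
  The hypotheses say that asymptotic upper and lower bounds of \<open>r\<close> may be improved by the contraction
  \<open>u \<mapsto> b + s * u\<close>.  Hence the infimum \<open>U\<close> of the upper bounds satisfies \<open>U \<le> b + s * U\<close>
  and the supremum of the lower bounds the reverse inequality, so both equal the fixed point.
\<close>

lemma affine_recursion_limit:
  fixes r :: "real \<Rightarrow> real"
  assumes b: "0 < b" and s: "0 \<le> s" "s < 1"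
    and nonneg: "\<And>x. 0 \<le> r x" and bdd: "\<forall>\<^sub>F x in at_top. r x \<le> D"
    and up: "\<And>u v. \<forall>\<^sub>F x in at_top. r x \<le> u \<Longrightarrow> b + s * u < v \<Longrightarrow> \<forall>\<^sub>F x in at_top. r x \<le> v"
    and low: "\<And>u v. 0 \<le> u \<Longrightarrow> \<forall>\<^sub>F x in at_top. u \<le> r x \<Longrightarrow> v < b + s * u \<Longrightarrow> \<forall>\<^sub>F x in at_top. v \<le> r x"
  shows "(r \<longlongrightarrow> b / (1 - s)) at_top"
proof -
  define U where "U = {u. \<forall>\<^sub>F x in at_top. r x \<le> u}"
  define l where "l = {u. 0 \<le> u \<and> (\<forall>\<^sub>F x in at_top. u \<le> r x)}"
  have U0: "D \<in> U" "\<And>u. u \<in> U \<Longrightarrow> 0 \<le> u"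
  proof -
    show "D \<in> U" using bdd by (simp add: U_def)
    fix u assume "u \<in> U"
    then have "\<forall>\<^sub>F x in at_top. r x \<le> u" by (simp add: U_def)
    then obtain x where "r x \<le> u" by (auto simp: eventually_at_top_linorder)
    then show "0 \<le> u" using nonneg[of x] by linarith
  qed
  have l0: "0 \<in> l" "\<And>u. u \<in> l \<Longrightarrow> u \<le> D"
  proof -
    show "0 \<in> l" using nonneg by (simp add: l_def)
    fix u assume "u \<in> l"
    then have "\<forall>\<^sub>F x in at_top. u \<le> r x" by (simp add: l_def)
    with bdd have "\<forall>\<^sub>F x in at_top. u \<le> r x \<and> r x \<le> D" by eventually_elim auto
    then obtain x where "u \<le> r x \<and> r x \<le> D" by (auto simp: eventually_at_top_linorder)
    then show "u \<le> D" by linarith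
  qed
  have bU: "bdd_below U" using U0(2) by (rule bdd_belowI)
  have bl: "bdd_above l" using l0(2) by (rule bdd_aboveI)
  have "Inf U \<le> b + s * Inf U"
  proof (rule field_le_epsilon)
    fix e :: real assume e: "e > 0"
    obtain u where u: "u \<in> U" "u < Inf U + e"
      using cInf_lessD[of U "Inf U + e"] U0 e by auto
    have "s * u \<le> s * (Inf U + e)" using u s by (intro mult_left_mono) auto
    moreover have "s * e < e" using s e by simp
    ultimately have "b + s * u < b + s * Inf U + e" by (simp add: algebra_simps)
    then have "b + s * Inf U + e \<in> U" using up u(1) by (simp add: U_def)
    then show "Inf U \<le> b + s * Inf U + e" using bU by (rule cInf_lower)
  qed
  then have IU: "Inf U \<le> b / (1 - s)" using s by (simp add: field_simps)
  have "b + s * Sup l \<le> Sup l"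
  proof (rule field_le_epsilon)
    fix e :: real assume e: "e > 0"
    obtain u where u: "u \<in> l" "Sup l - e < u"
      using less_cSupD[of l "Sup l - e"] l0 e by auto
    have "s * (Sup l - e) \<le> s * u" using u s by (intro mult_left_mono) auto
    moreover have "s * e < e" using s e by simp
    ultimately have "b + s * Sup l - e < b + s * u" by (simp add: algebra_simps)
    have ev: "\<forall>\<^sub>F x in at_top. b + s * Sup l - e \<le> r x"
      using low[of u "b + s * Sup l - e"] \<open>b + s * Sup l - e < b + s * u\<close> u(1)
      unfolding l_def by blast
    have "b + s * Sup l - e \<le> Sup l"
    proof (cases "0 \<le> b + s * Sup l - e")
      case True
      then show ?thesis using ev by (intro cSup_upper bl) (simp add: l_def)
    next
      case False
      then show ?thesis using cSup_upper[OF l0(1) bl] by linarith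
    qed
    then show "b + s * Sup l \<le> Sup l + e" by simp
  qed
  then have Sl: "b / (1 - s) \<le> Sup l" using s by (simp add: field_simps)
  show ?thesis
  proof (rule order_tendstoI)
    fix v assume "v < b / (1 - s)"
    then obtain u where "u \<in> l" "v < u" using less_cSupD[of l v] l0 Sl by fastforce
    then have "\<forall>\<^sub>F x in at_top. u \<le> r x" by (simp add: l_def)
    then show "\<forall>\<^sub>F x in at_top. v < r x" by eventually_elim (use \<open>v < u\<close> in linarith)
  next
    fix v assume "b / (1 - s) < v"
    then obtain u where "u \<in> U" "u < v" using cInf_lessD[of U v] U0 IU by fastforce
    then have "\<forall>\<^sub>F x in at_top. r x \<le> u" by (simp add: U_def)
    then show "\<forall>\<^sub>F x in at_top. r x < v" by eventually_elim (use \<open>u < v\<close> in linarith)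
  qed
qed

section \<open>Deviations of sums of independent variables\<close>

text \<open>
  The second-order term of the exponential of a truncated variable is controlled by the power \<open>p\<close>
  alone, since \<open>(v / y)\<^sup>2 \<le> (v / y) powr p\<close> for \<open>v \<le> y\<close>.
\<close>

lemma exp_trunc_bound:
  fixes h u y p :: real
  assumes "0 \<le> h" "0 < y" "0 \<le> u" "0 \<le> p" "p \<le> 2"
  shows "exp (h * min u y) \<le> 1 + h * u + 2 * exp (2 * h * y) * y powr (- p) * u powr p"
proof -
  define v where "v = min u y"
  define z w where "z = h * v" and "w = h * y"
  have v: "0 \<le> v" "v \<le> y" "v \<le> u" using assms by (auto simp: v_def)
  have zw: "0 \<le> z" "z \<le> w" using assms v by (auto simp: z_def w_def mult_left_mono)
  have "1 + (- z) \<le> exp (- z)" by (rule exp_ge_add_one_self)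
  then have "(1 - z) * exp z \<le> exp (- z) * exp z" by (intro mult_right_mono) auto
  then have e1: "exp z \<le> 1 + z * exp z"
    by (simp only: exp_add[symmetric]) (simp add: left_diff_distrib)
  then have "z * exp z \<le> z * (1 + z * exp z)" using zw by (intro mult_left_mono) auto
  with e1 have "exp z \<le> 1 + z + z\<^sup>2 * exp z"
    by (simp add: distrib_left power2_eq_square mult.assoc)
  moreover have "z\<^sup>2 * exp z \<le> 2 * exp (2 * w) * (v / y) powr p"
  proof -
    have "(v / y)\<^sup>2 \<le> (v / y) powr p"
    proof (cases "v = 0")
      case False
      then have "(v / y) powr 2 \<le> (v / y) powr p" using v assms by (intro powr_mono') auto
      then show ?thesis using v False assms by simp
    qed simp
    have zz: "z\<^sup>2 = w\<^sup>2 * (v / y)\<^sup>2" using assms by (simp add: z_def w_def power2_eq_square)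
    have "1 + w + w\<^sup>2 / 2 \<le> exp w" using zw by (intro exp_lower_Taylor_quadratic) auto
    then have "w\<^sup>2 \<le> 2 * exp w" using zw by auto
    then have "z\<^sup>2 \<le> 2 * exp w * (v / y) powr p"
      unfolding zz using \<open>(v / y)\<^sup>2 \<le> (v / y) powr p\<close> by (intro mult_mono) auto
    then have "z\<^sup>2 * exp z \<le> (2 * exp w * (v / y) powr p) * exp w"
      using zw by (intro mult_mono) auto
    also have "\<dots> = 2 * exp (2 * w) * (v / y) powr p"
    proof -
      have "exp (2 * w) = exp w * exp w" by (simp add: exp_double power2_eq_square)
      then show ?thesis by (simp only: mult_ac)
    qed
    finally show ?thesis .
  qed
  moreover have "(v / y) powr p \<le> y powr (- p) * u powr p"
  proof -
    have "(v / y) powr p = y powr (- p) * v powr p"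
      using v assms by (simp add: powr_divide powr_minus divide_simps)
    moreover have "v powr p \<le> u powr p" using v assms by (intro powr_mono2) auto
    ultimately show ?thesis by (simp add: mult_left_mono)
  qed
  then have "2 * exp (2 * w) * (v / y) powr p \<le> 2 * exp (2 * w) * (y powr (- p) * u powr p)"
    by (intro mult_left_mono) auto
  moreover have "z \<le> h * u" using v assms by (auto simp: z_def intro: mult_left_mono)
  ultimately have "exp z \<le> 1 + h * u + 2 * exp (2 * w) * (y powr (- p) * u powr p)" by linarith
  then show ?thesis by (simp add: z_def w_def v_def mult.assoc)
qed

lemma exp_minus_bound:
  fixes u p :: real
  assumes "0 \<le> u" "1 \<le> p" "p \<le> 2"
  shows "exp (- u) \<le> 1 - u + u powr p"
proof (cases "u \<le> 1")
  case True
  have "exp (- u) * (1 + u) \<le> exp (- u) * exp u" by (intro mult_left_mono exp_ge_add_one_self) auto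
  then have "exp (- u) * (1 + u) \<le> 1" by (simp only: exp_add[symmetric]) simp
  then have "exp (- u) \<le> 1 / (1 + u)" using assms by (simp add: pos_le_divide_eq)
  also have "\<dots> \<le> 1 - u + u\<^sup>2"
  proof -
    have "(1 - u + u\<^sup>2) * (1 + u) = 1 + u ^ 3"
      by (simp add: algebra_simps power2_eq_square power3_eq_cube)
    then show ?thesis using assms by (simp add: pos_divide_le_eq)
  qed
  also have "u\<^sup>2 \<le> u powr p"
  proof (cases "u = 0")
    case False
    then have "u powr 2 \<le> u powr p" using True assms by (intro powr_mono') auto
    then show ?thesis using assms False by simp
  qed simp
  finally show ?thesis by simp
next
  case False
  then have "u powr 1 \<le> u powr p" using assms by (intro powr_mono) auto
  moreover have "exp (- u) \<le> 1" using assms by simp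
  ultimately show ?thesis using assms by (simp only: powr_one)
qed

text \<open>Bonferroni's inequality for \<open>k\<close> independent events of probability \<open>q\<close>.\<close>

lemma one_minus_power_le:
  fixes q :: real
  assumes "0 \<le> q" "q \<le> 1"
  shows "(1 - q) ^ k \<le> 1 - real k * q + (real k)\<^sup>2 * q\<^sup>2"
proof (induction k)
  case (Suc k)
  have "(1 - q) ^ Suc k \<le> (1 - q) * (1 - real k * q + (real k)\<^sup>2 * q\<^sup>2)"
    using Suc assms by (auto intro!: mult_left_mono)
  also have "\<dots> = 1 - real (Suc k) * q + (real k + (real k)\<^sup>2) * q\<^sup>2 - (real k)\<^sup>2 * q\<^sup>2 * q"
    by (simp add: algebra_simps power2_eq_square)
  also have "\<dots> \<le> 1 - real (Suc k) * q + (real (Suc k))\<^sup>2 * q\<^sup>2"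
  proof -
    have "(real k + (real k)\<^sup>2) * q\<^sup>2 \<le> (real (Suc k))\<^sup>2 * q\<^sup>2"
      by (intro mult_right_mono) (auto simp: algebra_simps power2_eq_square)
    moreover have "0 \<le> (real k)\<^sup>2 * q\<^sup>2 * q" using assms by simp
    ultimately show ?thesis by linarith
  qed
  finally show ?case .
qed auto

locale iid_nonneg = prob_space M for M :: "'a measure" +
  fixes R :: "'a \<Rightarrow> real" and X :: "nat \<Rightarrow> 'a \<Rightarrow> real"
  assumes R_measurable [measurable]: "R \<in> borel_measurable M"
    and R_nonneg: "\<And>\<omega>. \<omega> \<in> space M \<Longrightarrow> 0 \<le> R \<omega>"
    and R_integrable: "integrable M R" and R_mean: "expectation R = 1"
    and X_indep: "indep_vars (\<lambda>_. borel) X {1..}"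
    and X_distr: "\<And>j. 1 \<le> j \<Longrightarrow> distr M borel (X j) = distr M borel R"
begin

definition tail_R :: "real \<Rightarrow> real" where "tail_R y = prob {\<omega>\<in>space M. y < R \<omega>}"

definition S :: "nat \<Rightarrow> 'a \<Rightarrow> real" where "S k \<omega> = (\<Sum>j=1..k. X j \<omega>)"

definition tail_S :: "nat \<Rightarrow> real \<Rightarrow> real" where "tail_S k y = prob {\<omega>\<in>space M. y < S k \<omega>}"

lemma X_measurable: "1 \<le> j \<Longrightarrow> X j \<in> borel_measurable M"
  using X_indep by (auto simp: indep_vars_def)

lemma S_measurable [measurable]: "S k \<in> borel_measurable M"
  unfolding S_def by (intro borel_measurable_sum X_measurable) auto

lemma tail_R_nonneg: "0 \<le> tail_R y" and tail_R_le_1: "tail_R y \<le> 1"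
  by (auto simp: tail_R_def)

lemma tail_R_antimono: "x \<le> y \<Longrightarrow> tail_R y \<le> tail_R x"
  unfolding tail_R_def by (intro finite_measure_mono) auto

lemma tail_S_nonneg: "0 \<le> tail_S k y" and tail_S_le_1: "tail_S k y \<le> 1"
  by (auto simp: tail_S_def)

lemma tail_S_antimono: "x \<le> y \<Longrightarrow> tail_S k y \<le> tail_S k x"
  unfolding tail_S_def by (intro finite_measure_mono) auto

lemma prob_X:
  assumes "1 \<le> j" "B \<in> sets borel"
  shows "prob {\<omega>\<in>space M. X j \<omega> \<in> B} = prob {\<omega>\<in>space M. R \<omega> \<in> B}"
proof -
  have "measure (distr M borel (X j)) B = measure (distr M borel R) B" using X_distr assms by simp
  then show ?thesis using assms X_measurable[OF assms(1)]
    by (simp add: measure_distr vimage_def Int_def conj_commute)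
qed

lemma expectation_X:
  fixes f :: "real \<Rightarrow> real"
  assumes "1 \<le> j" and [measurable]: "f \<in> borel_measurable borel"
  shows "expectation (\<lambda>\<omega>. f (X j \<omega>)) = expectation (\<lambda>\<omega>. f (R \<omega>))"
    and "integrable M (\<lambda>\<omega>. f (X j \<omega>)) \<longleftrightarrow> integrable M (\<lambda>\<omega>. f (R \<omega>))"
proof -
  note [measurable] = X_measurable[OF assms(1)]
  have "expectation (\<lambda>\<omega>. f (X j \<omega>)) = integral\<^sup>L (distr M borel (X j)) f" 
    by (subst integral_distr) auto
  also have "\<dots> = expectation (\<lambda>\<omega>. f (R \<omega>))"
    unfolding X_distr[OF assms(1)] by (subst integral_distr) auto
  finally show "expectation (\<lambda>\<omega>. f (X j \<omega>)) = expectation (\<lambda>\<omega>. f (R \<omega>))" .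
  have "integrable M (\<lambda>\<omega>. f (X j \<omega>)) \<longleftrightarrow> integrable (distr M borel (X j)) f"
    by (subst integrable_distr_eq) auto
  also have "\<dots> \<longleftrightarrow> integrable M (\<lambda>\<omega>. f (R \<omega>))"
    unfolding X_distr[OF assms(1)] by (subst integrable_distr_eq) auto
  finally show "integrable M (\<lambda>\<omega>. f (X j \<omega>)) \<longleftrightarrow> integrable M (\<lambda>\<omega>. f (R \<omega>))" .
qed

lemma X_nonneg_AE: "AE \<omega> in M. \<forall>j\<ge>1. 0 \<le> X j \<omega>"
proof -
  have "AE \<omega> in M. 1 \<le> j \<longrightarrow> 0 \<le> X j \<omega>" for j
  proof (cases "1 \<le> j")
    case True
    note [measurable] = X_measurable[OF True]
    have "prob {\<omega>\<in>space M. X j \<omega> \<in> {0..}} = prob {\<omega>\<in>space M. R \<omega> \<in> {0..}}"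
      by (rule prob_X[OF True]) simp
    also have "{\<omega>\<in>space M. R \<omega> \<in> {0..}} = space M" using R_nonneg by auto
    finally have "prob {\<omega>\<in>space M. X j \<omega> \<in> {0..}} = 1" by (simp add: prob_space)
    then have "AE \<omega> in M. \<omega> \<in> {\<omega>\<in>space M. X j \<omega> \<in> {0..}}" by (intro AE_prob_1)
    then show ?thesis by eventually_elim auto
  qed auto
  then show ?thesis by (simp add: AE_all_countable)
qed

lemma chernoff:
  assumes g [measurable]: "g \<in> borel_measurable borel" and int: "integrable M (\<lambda>\<omega>. exp (g (R \<omega>)))"
  shows "prob {\<omega>\<in>space M. y \<le> (\<Sum>j=1..k. g (X j \<omega>))} \<le> exp (- y) * expectation (\<lambda>\<omega>. exp (g (R \<omega>))) ^ k"
proof -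
  have ind: "indep_vars (\<lambda>_. borel) (\<lambda>j \<omega>. exp (g (X j \<omega>))) {1..k}"
    by (intro indep_vars_compose2[OF indep_vars_subset[OF X_indep]]) auto
  have i: "integrable M (\<lambda>\<omega>. exp (g (X j \<omega>)))" if "j \<in> {1..k}" for j
    using expectation_X(2)[of j "\<lambda>x. exp (g x)"] int that by auto
  have intp: "integrable M (\<lambda>\<omega>. \<Prod>j=1..k. exp (g (X j \<omega>)))"
    by (rule indep_vars_integrable[OF _ ind i]) auto
  have "prob {\<omega>\<in>space M. y \<le> (\<Sum>j=1..k. g (X j \<omega>))}
      = prob {\<omega>\<in>space M. (\<Prod>j=1..k. exp (g (X j \<omega>))) \<ge> exp y}"
    by (simp flip: exp_sum)
  also have "\<dots> \<le> expectation (\<lambda>\<omega>. \<Prod>j=1..k. exp (g (X j \<omega>))) / exp y"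
    by (intro integral_Markov_inequality_measure[where A="{}"] intp) (auto intro!: prod_nonneg)
  also have "expectation (\<lambda>\<omega>. \<Prod>j=1..k. exp (g (X j \<omega>))) = (\<Prod>j=1..k. expectation (\<lambda>\<omega>. exp (g (X j \<omega>))))"
    by (rule indep_vars_lebesgue_integral[OF _ ind i]) auto
  also have "\<dots> = (\<Prod>j=1..k. expectation (\<lambda>\<omega>. exp (g (R \<omega>))))"
    by (intro prod.cong refl expectation_X(1)[of _ "\<lambda>x. exp (g x)"]) auto
  finally show ?thesis by (simp add: exp_minus field_simps)
qed

lemma max_prob:
  "prob {\<omega>\<in>space M. \<exists>j\<in>{1..k}. y < X j \<omega>} = 1 - (1 - tail_R y) ^ k"
proof (cases "k = 0")
  case False
  note X_measurable[measurable]
  have 1: "prob (X j -` {..y} \<inter> space M) = 1 - tail_R y" if "j \<in> {1..k}" for j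
  proof -
    have "X j -` {..y} \<inter> space M = {\<omega>\<in>space M. X j \<omega> \<in> {..y}}" by auto
    then have "prob (X j -` {..y} \<inter> space M) = prob {\<omega>\<in>space M. R \<omega> \<in> {..y}}"
      using prob_X[of j "{..y}"] that by simp
    also have "{\<omega>\<in>space M. R \<omega> \<in> {..y}} = space M - {\<omega>\<in>space M. y < R \<omega>}" by auto
    also have "prob \<dots> = 1 - tail_R y" unfolding tail_R_def by (rule prob_compl) auto
    finally show ?thesis .
  qed
  have "prob (\<Inter>j\<in>{1..k}. X j -` {..y} \<inter> space M) = (\<Prod>j\<in>{1..k}. prob (X j -` {..y} \<inter> space M))"
    using False by (intro indep_varsD[OF X_indep]) auto
  also have "\<dots> = (1 - tail_R y) ^ k" using 1 by simp
  finally have 2: "prob (\<Inter>j\<in>{1..k}. X j -` {..y} \<inter> space M) = (1 - tail_R y) ^ k" .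
  have "{\<omega>\<in>space M. \<exists>j\<in>{1..k}. y < X j \<omega>} = space M - (\<Inter>j\<in>{1..k}. X j -` {..y} \<inter> space M)"
    using False by (auto simp: not_le)
  also have "prob \<dots> = 1 - prob (\<Inter>j\<in>{1..k}. X j -` {..y} \<inter> space M)"
    using False by (intro prob_compl sets.finite_INT measurable_sets[OF X_measurable]) auto
  finally show ?thesis using 2 by simp
qed (simp add: Bex_def)

text \<open>
  A nonnegative sum is at least its largest summand.  The summands are only almost surely
  nonnegative, because just their laws agree with that of \<open>R\<close>.
\<close>

lemma tail_S_ge_single_jump: "real k * tail_R y - (real k)\<^sup>2 * (tail_R y)\<^sup>2 \<le> tail_S k y"
proof -
  have "real k * tail_R y - (real k)\<^sup>2 * (tail_R y)\<^sup>2 \<le> 1 - (1 - tail_R y) ^ k"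
    using one_minus_power_le[OF tail_R_nonneg tail_R_le_1, of y k] by simp
  also have "\<dots> = prob {\<omega>\<in>space M. \<exists>j\<in>{1..k}. y < X j \<omega>}" by (rule max_prob[symmetric])
  also have "\<dots> \<le> tail_S k y" unfolding tail_S_def
  proof (rule finite_measure_mono_AE)
    show "AE \<omega> in M. \<omega> \<in> {\<omega>\<in>space M. \<exists>j\<in>{1..k}. y < X j \<omega>} \<longrightarrow> \<omega> \<in> {\<omega>\<in>space M. y < S k \<omega>}"
      using X_nonneg_AE
    proof eventually_elim
      case (elim \<omega>)
      have "X j \<omega> \<le> S k \<omega>" if "j \<in> {1..k}" for j
        unfolding S_def using that elim by (intro member_le_sum) auto
      then show ?case by (auto intro: less_le_trans)
    qed
  qed auto
  finally show ?thesis .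
qed

lemma prob_two_large:
  assumes "1 \<le> i" "1 \<le> j" "i \<noteq> j"
  shows "prob {\<omega>\<in>space M. y < X i \<omega> \<and> y < X j \<omega>} = (tail_R y)\<^sup>2"
proof -
  have "prob (\<Inter>l\<in>{i,j}. X l -` {y<..} \<inter> space M) = (\<Prod>l\<in>{i,j}. prob (X l -` {y<..} \<inter> space M))"
    using assms by (intro indep_varsD[OF X_indep]) auto
  also have "(\<Inter>l\<in>{i,j}. X l -` {y<..} \<inter> space M) = {\<omega>\<in>space M. y < X i \<omega> \<and> y < X j \<omega>}" by auto
  finally have "prob {\<omega>\<in>space M. y < X i \<omega> \<and> y < X j \<omega>} = (\<Prod>l\<in>{i,j}. prob (X l -` {y<..} \<inter> space M))" .
  moreover have "X l -` {y<..} \<inter> space M = {\<omega>\<in>space M. X l \<omega> \<in> {y<..}}" for l by auto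
  ultimately show ?thesis using assms prob_X[of i "{y<..}"] prob_X[of j "{y<..}"]
    by (simp add: tail_R_def power2_eq_square)
qed

context
  fixes p :: real
  assumes p: "1 < p" "p \<le> 2" and Rp: "integrable M (\<lambda>\<omega>. R \<omega> powr p)"
begin

lemma expectation_Rp_nonneg: "0 \<le> expectation (\<lambda>\<omega>. R \<omega> powr p)"
  by (intro integral_nonneg_AE) auto

lemma tail_R_le_moment:
  assumes "0 < y" shows "tail_R y \<le> expectation (\<lambda>\<omega>. R \<omega> powr p) * y powr (- p)"
proof -
  have "tail_R y \<le> prob {\<omega>\<in>space M. R \<omega> powr p \<ge> y powr p}"
    unfolding tail_R_def using assms p by (intro finite_measure_mono) (auto intro!: powr_mono2)
  also have "\<dots> \<le> expectation (\<lambda>\<omega>. R \<omega> powr p) / y powr p"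
    using assms by (intro integral_Markov_inequality_measure[where A="{}"] Rp) auto
  finally show ?thesis by (simp add: powr_minus divide_inverse)
qed

lemma truncated_mgf:
  assumes h: "0 \<le> h" and y: "0 < y"
  shows "integrable M (\<lambda>\<omega>. exp (h * min (R \<omega>) y))"
    and "expectation (\<lambda>\<omega>. exp (h * min (R \<omega>) y))
       \<le> exp (h + 2 * exp (2 * h * y) * y powr (- p) * expectation (\<lambda>\<omega>. R \<omega> powr p))"
proof -
  show i: "integrable M (\<lambda>\<omega>. exp (h * min (R \<omega>) y))"
  proof (rule integrable_const_bound[where B="exp (h * y)"])
    have "norm (exp (h * min (R \<omega>) y)) \<le> exp (h * y)" for \<omega>
      using mult_left_mono[OF min.cobounded2[of "R \<omega>" y] h] by simp
    then show "AE \<omega> in M. norm (exp (h * min (R \<omega>) y)) \<le> exp (h * y)" by simp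
  qed measurable
  have "expectation (\<lambda>\<omega>. exp (h * min (R \<omega>) y))
     \<le> expectation (\<lambda>\<omega>. 1 + h * R \<omega> + 2 * exp (2 * h * y) * y powr (- p) * R \<omega> powr p)"
  proof (rule integral_mono[OF i])
    fix \<omega> assume "\<omega> \<in> space M"
    then show "exp (h * min (R \<omega>) y) \<le> 1 + h * R \<omega> + 2 * exp (2 * h * y) * y powr (- p) * R \<omega> powr p"
      using h y p R_nonneg by (intro exp_trunc_bound) auto
  qed (use R_integrable Rp in simp)
  also have "\<dots> = 1 + h + 2 * exp (2 * h * y) * y powr (- p) * expectation (\<lambda>\<omega>. R \<omega> powr p)"
    using R_integrable Rp by (simp add: R_mean prob_space)
  also have "\<dots> \<le> exp (h + 2 * exp (2 * h * y) * y powr (- p) * expectation (\<lambda>\<omega>. R \<omega> powr p))"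
    using exp_ge_add_one_self[of "h + 2 * exp (2 * h * y) * y powr (- p) * expectation (\<lambda>\<omega>. R \<omega> powr p)"]
    by (simp add: algebra_simps)
  finally show "expectation (\<lambda>\<omega>. exp (h * min (R \<omega>) y))
       \<le> exp (h + 2 * exp (2 * h * y) * y powr (- p) * expectation (\<lambda>\<omega>. R \<omega> powr p))" .
qed

text \<open>
  Chernoff's bound for the summands truncated at \<open>\<epsilon> * x\<close>.  The parameter \<open>h\<close> is determined
  by \<open>exp (2 * h * \<epsilon> * x) = x powr (p - 1)\<close>: then the \<open>p\<close>-th moments of \<open>k \<le> x\<close> summands
  contribute only a constant factor.  What remains is \<open>exp (- h * \<delta> * x)\<close>, a power of \<open>x\<close>
  whose exponent is proportional to \<open>\<delta> / \<epsilon>\<close>, so any power \<open>\<beta>\<close> is reached by a small \<open>\<epsilon>\<close>.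
\<close>

lemma truncated_sum_tail:
  assumes "0 < \<delta>" "0 < \<beta>"
  shows "\<exists>\<epsilon>>0. \<exists>C>0. \<forall>x\<ge>1. \<forall>k. real k \<le> x \<longrightarrow>
    prob {\<omega>\<in>space M. real k + \<delta> * x \<le> (\<Sum>j=1..k. min (X j \<omega>) (\<epsilon> * x))} \<le> C * x powr (- \<beta>)"
proof -
  define m where "m = expectation (\<lambda>\<omega>. R \<omega> powr p)"
  define \<epsilon> where "\<epsilon> = (p - 1) * \<delta> / (2 * \<beta>)"
  define C where "C = exp (2 * \<epsilon> powr (- p) * m)"
  have \<epsilon>: "\<epsilon> > 0" using assms p by (simp add: \<epsilon>_def)
  have m: "m \<ge> 0" unfolding m_def by (rule expectation_Rp_nonneg)
  have "prob {\<omega>\<in>space M. real k + \<delta> * x \<le> (\<Sum>j=1..k. min (X j \<omega>) (\<epsilon> * x))} \<le> C * x powr (- \<beta>)"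
    if x: "x \<ge> 1" and k: "real k \<le> x" for x k
  proof -
    define h where "h = (p - 1) * ln x / (2 * \<epsilon> * x)"
    define E where "E = 2 * x powr (p - 1) * (\<epsilon> * x) powr (- p) * m"
    have h: "h \<ge> 0" using p x \<epsilon> by (simp add: h_def)
    have hy: "exp (2 * h * (\<epsilon> * x)) = x powr (p - 1)"
      using x \<epsilon> by (simp add: h_def powr_def)
    have h\<delta>: "h * \<delta> * x = \<beta> * ln x" using x \<epsilon> assms p by (simp add: h_def \<epsilon>_def field_simps)
    have hE: "expectation (\<lambda>\<omega>. exp (h * min (R \<omega>) (\<epsilon> * x))) \<le> exp (h + E)"
      using truncated_mgf(2)[OF h, of "\<epsilon> * x"] x \<epsilon> unfolding hy E_def m_def by simp
    have kE: "real k * E \<le> 2 * \<epsilon> powr (- p) * m"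
    proof -
      have "real k * E \<le> x * E" using k m by (intro mult_right_mono) (auto simp: E_def)
      also have "\<dots> = 2 * \<epsilon> powr (- p) * m * (x powr 1 * x powr (p - 1) * x powr (- p))"
        using x \<epsilon> by (simp add: E_def powr_mult)
      also have "x powr 1 * x powr (p - 1) * x powr (- p) = 1"
        using x by (simp only: powr_add[symmetric]) simp
      finally show ?thesis by simp
    qed
    have "prob {\<omega>\<in>space M. real k + \<delta> * x \<le> (\<Sum>j=1..k. min (X j \<omega>) (\<epsilon> * x))}
       \<le> prob {\<omega>\<in>space M. h * (real k + \<delta> * x) \<le> (\<Sum>j=1..k. h * min (X j \<omega>) (\<epsilon> * x))}"
    proof (rule finite_measure_mono)
      show "{\<omega>\<in>space M. real k + \<delta> * x \<le> (\<Sum>j=1..k. min (X j \<omega>) (\<epsilon> * x))}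
         \<subseteq> {\<omega>\<in>space M. h * (real k + \<delta> * x) \<le> (\<Sum>j=1..k. h * min (X j \<omega>) (\<epsilon> * x))}"
        unfolding sum_distrib_left[symmetric] using h by (auto intro: mult_left_mono)
      have [measurable]: "(\<lambda>\<omega>. \<Sum>j=1..k. h * min (X j \<omega>) (\<epsilon> * x)) \<in> borel_measurable M"
        by (intro borel_measurable_sum borel_measurable_times borel_measurable_min X_measurable) auto
      show "{\<omega>\<in>space M. h * (real k + \<delta> * x) \<le> (\<Sum>j=1..k. h * min (X j \<omega>) (\<epsilon> * x))} \<in> events"
        by measurable
    qed
    also have "\<dots> \<le> exp (- (h * (real k + \<delta> * x))) * expectation (\<lambda>\<omega>. exp (h * min (R \<omega>) (\<epsilon> * x))) ^ k"
      using x \<epsilon> h by (intro chernoff truncated_mgf) auto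
    also have "\<dots> \<le> exp (- (h * (real k + \<delta> * x))) * exp (h + E) ^ k"
      using hE by (intro mult_left_mono power_mono) (auto intro!: integral_nonneg_AE)
    also have "\<dots> = exp (real k * E) * exp (- (h * \<delta> * x))"
      by (simp only: exp_of_nat_mult[symmetric] exp_add[symmetric]) (simp add: algebra_simps)
    also have "\<dots> \<le> C * exp (- (h * \<delta> * x))" using kE by (simp add: C_def)
    also have "exp (- (h * \<delta> * x)) = x powr (- \<beta>)" using x unfolding h\<delta> by (simp add: powr_def)
    finally show ?thesis .
  qed
  moreover have "C > 0" by (simp add: C_def)
  ultimately show ?thesis using \<epsilon> by blast
qed

text \<open>
  If no summand exceeds \<open>s * x\<close> and at most one exceeds \<open>\<epsilon> * x\<close>, then truncation at \<open>\<epsilon> * x\<close>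
  lowers the sum by at most \<open>s * x\<close>; so a sum above \<open>k + (s + \<delta>) * x\<close> requires one jump
  above \<open>s * x\<close>, two jumps above \<open>\<epsilon> * x\<close>, or an exceptionally large truncated sum.
\<close>

lemma tail_S_le_jumps:
  assumes "0 < \<delta>" "0 < \<beta>"
  shows "\<exists>\<epsilon>>0. \<exists>C>0. \<forall>x\<ge>1. \<forall>k. real k \<le> x \<longrightarrow> (\<forall>s\<ge>0.
    tail_S k (real k + (s + \<delta>) * x) \<le> real k * tail_R (s * x) + (real k)\<^sup>2 * (tail_R (\<epsilon> * x))\<^sup>2 + C * x powr (- \<beta>))"
proof -
  obtain \<epsilon> C where \<epsilon>: "\<epsilon> > 0" "C > 0" and tr: "\<And>x k. x \<ge> 1 \<Longrightarrow> real k \<le> x \<Longrightarrow>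
    prob {\<omega>\<in>space M. real k + \<delta> * x \<le> (\<Sum>j=1..k. min (X j \<omega>) (\<epsilon> * x))} \<le> C * x powr (- \<beta>)"
    using truncated_sum_tail[OF assms] by blast
  have "tail_S k (real k + (s + \<delta>) * x) \<le> real k * tail_R (s * x) + (real k)\<^sup>2 * (tail_R (\<epsilon> * x))\<^sup>2 + C * x powr (- \<beta>)"
    if x: "x \<ge> 1" and k: "real k \<le> x" and s: "s \<ge> 0" for x k s
  proof -
    define u where "u = \<epsilon> * x"
    have u: "u > 0" using x \<epsilon> by (simp add: u_def)
    define I where "I = {ij \<in> {1..k} \<times> {1..k}. fst ij \<noteq> snd ij}"
    define A where "A j = {\<omega>\<in>space M. s * x < X j \<omega>}" for j
    define B where "B ij = {\<omega>\<in>space M. u < X (fst ij) \<omega> \<and> u < X (snd ij) \<omega>}" for ij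
    define D where "D = {\<omega>\<in>space M. real k + \<delta> * x \<le> (\<Sum>j=1..k. min (X j \<omega>) u)}"
    have I: "finite I" unfolding I_def by (rule finite_subset[of _ "{1..k} \<times> {1..k}"]) auto
    have cI: "card I \<le> k * k"
      using card_mono[of "{1..k} \<times> {1..k}" I] by (auto simp: I_def)
    have A: "A j \<in> events" if "j \<in> {1..k}" for j using that X_measurable[of j] by (simp add: A_def)
    have B: "B ij \<in> events" if "ij \<in> I" for ij
      using that X_measurable[of "fst ij"] X_measurable[of "snd ij"] by (auto simp: B_def I_def)
    have D: "D \<in> events" 
    proof -
      have [measurable]: "(\<lambda>\<omega>. \<Sum>j=1..k. min (X j \<omega>) u) \<in> borel_measurable M"
        by (intro borel_measurable_sum borel_measurable_min X_measurable) auto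
      show ?thesis unfolding D_def by measurable
    qed
    have "{\<omega>\<in>space M. real k + (s + \<delta>) * x < S k \<omega>} \<subseteq> (\<Union>j\<in>{1..k}. A j) \<union> (\<Union>ij\<in>I. B ij) \<union> D"
    proof
      fix \<omega> assume w: "\<omega> \<in> {\<omega>\<in>space M. real k + (s + \<delta>) * x < S k \<omega>}"
      show "\<omega> \<in> (\<Union>j\<in>{1..k}. A j) \<union> (\<Union>ij\<in>I. B ij) \<union> D"
      proof (rule ccontr)
        assume "\<not> ?thesis"
        then have n: "\<And>j. j \<in> {1..k} \<Longrightarrow> \<omega> \<notin> A j" "\<And>ij. ij \<in> I \<Longrightarrow> \<omega> \<notin> B ij" "\<omega> \<notin> D"
          by blast+
        have no: "X j \<omega> \<le> s * x" if "j \<in> {1..k}" for j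
          using n(1)[OF that] w by (auto simp: A_def not_less)
        have two: "X j \<omega> \<le> u" if "i \<in> {1..k}" "j \<in> {1..k}" "i \<noteq> j" "u < X i \<omega>" for i j
          using n(2)[of "(i, j)"] w that by (auto simp: B_def I_def not_less)
        have nD: "(\<Sum>j=1..k. min (X j \<omega>) u) < real k + \<delta> * x"
          using n(3) w by (auto simp: D_def not_le)
        have "S k \<omega> \<le> (\<Sum>j=1..k. min (X j \<omega>) u) + s * x"
        proof (cases "\<exists>i\<in>{1..k}. u < X i \<omega>")
          case True
          then obtain i where i: "i \<in> {1..k}" "u < X i \<omega>" by blast
          have "S k \<omega> = X i \<omega> + (\<Sum>j\<in>{1..k}-{i}. X j \<omega>)"
            unfolding S_def using i by (intro sum.remove) auto
          also have "(\<Sum>j\<in>{1..k}-{i}. X j \<omega>) = (\<Sum>j\<in>{1..k}-{i}. min (X j \<omega>) u)"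
            using two[OF i(1)] i(2) by (intro sum.cong) auto
          also have "\<dots> = (\<Sum>j=1..k. min (X j \<omega>) u) - u"
            using i by (simp add: sum_diff1)
          finally show ?thesis using no[OF i(1)] u by simp
        next
          case False
          then have "S k \<omega> = (\<Sum>j=1..k. min (X j \<omega>) u)"
            unfolding S_def by (intro sum.cong) (auto simp: not_less)
          then show ?thesis using s x by simp
        qed
        then show False using nD w by (simp add: algebra_simps)
      qed
    qed
    then have "tail_S k (real k + (s + \<delta>) * x) \<le> prob ((\<Union>j\<in>{1..k}. A j) \<union> (\<Union>ij\<in>I. B ij) \<union> D)"
      unfolding tail_S_def using A B D I by (intro finite_measure_mono) auto
    also have "\<dots> \<le> prob (\<Union>j\<in>{1..k}. A j) + prob (\<Union>ij\<in>I. B ij) + prob D"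
      using A B D I by (intro order_trans[OF measure_Un_le] add_mono measure_Un_le) auto
    also have "prob (\<Union>j\<in>{1..k}. A j) \<le> (\<Sum>j=1..k. prob (A j))"
      using A by (intro measure_UNION_le) auto
    also have "\<dots> = (\<Sum>j=1..k. tail_R (s * x))"
      using prob_X[of _ "{s * x<..}"] by (intro sum.cong) (auto simp: A_def tail_R_def)
    also have "prob (\<Union>ij\<in>I. B ij) \<le> (\<Sum>ij\<in>I. prob (B ij))"
      using B I by (intro measure_UNION_le) auto
    also have "\<dots> = (\<Sum>ij\<in>I. (tail_R u)\<^sup>2)"
      unfolding B_def by (intro sum.cong prob_two_large) (auto simp: I_def)
    also have "\<dots> \<le> (real k)\<^sup>2 * (tail_R u)\<^sup>2"
    proof -
      have "real (card I) \<le> (real k)\<^sup>2" 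
        using cI unfolding power2_eq_square of_nat_mult[symmetric] of_nat_le_iff .
      then show ?thesis by (simp add: mult_right_mono)
    qed
    also have "prob D \<le> C * x powr (- \<beta>)" unfolding D_def u_def by (rule tr[OF x k])
    finally show ?thesis by (simp add: u_def)
  qed
  then show ?thesis using \<epsilon> by blast
qed

text \<open>
  The weak law of large numbers from below, with an exponential rate: nonnegative summands have
  exponential moments of negative argument, and
  \<open>E (exp (- h * R)) \<le> 1 - h + h powr p * E (R powr p)\<close>, where the last term is negligible for small \<open>h\<close>.
\<close>

lemma sum_lower_tail:
  assumes \<delta>: "0 < \<delta>"
  shows "\<exists>\<kappa>>0. \<forall>k. 1 - exp (- \<kappa> * real k) \<le> tail_S k ((1 - \<delta>) * real k)"
proof -
  define m where "m = expectation (\<lambda>\<omega>. R \<omega> powr p)"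
  have m: "m \<ge> 0" unfolding m_def by (rule expectation_Rp_nonneg)
  define h where "h = (\<delta> / (2 * (m + 1))) powr (1 / (p - 1))"
  have h: "h > 0" using m \<delta> by (simp add: h_def)
  have "h powr (p - 1) = \<delta> / (2 * (m + 1))" using p m \<delta> by (simp add: h_def powr_powr)
  then have "h powr (p - 1) * m = \<delta> / 2 * (m / (m + 1))" by simp
  also have "\<dots> \<le> \<delta> / 2" using m \<delta> by (intro mult_left_le) auto
  finally have "h powr (p - 1) * m \<le> \<delta> / 2" .
  moreover have "h powr p = h * h powr (p - 1)" using h powr_add[of h 1 "p - 1"] by simp
  ultimately have hp: "h powr p * m \<le> h * \<delta> / 2" using h mult_left_mono[of "h powr (p - 1) * m" "\<delta> / 2" h]
    by (simp add: mult.assoc)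
  have i: "integrable M (\<lambda>\<omega>. exp (- h * R \<omega>))"
    using h R_nonneg by (intro integrable_const_bound[where B=1]) (auto intro!: AE_I2)
  have "expectation (\<lambda>\<omega>. exp (- h * R \<omega>)) \<le> expectation (\<lambda>\<omega>. 1 - h * R \<omega> + h powr p * R \<omega> powr p)"
  proof (intro integral_mono i)
    fix \<omega> assume "\<omega> \<in> space M"
    then show "exp (- h * R \<omega>) \<le> 1 - h * R \<omega> + h powr p * R \<omega> powr p"
      using exp_minus_bound[of "h * R \<omega>" p] h p R_nonneg by (simp add: powr_mult)
  qed (use R_integrable Rp in auto)
  also have "\<dots> = 1 - h + h powr p * m" using R_integrable Rp by (simp add: R_mean prob_space m_def)
  also have "\<dots> \<le> 1 + (h * \<delta> / 2 - h)" using hp by simp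
  also have "\<dots> \<le> exp (h * \<delta> / 2 - h)" by (rule exp_ge_add_one_self)
  finally have E: "expectation (\<lambda>\<omega>. exp (- h * R \<omega>)) \<le> exp (h * \<delta> / 2 - h)" .
  have "1 - exp (- (h * \<delta> / 2) * real k) \<le> tail_S k ((1 - \<delta>) * real k)" for k
  proof -
    have "{\<omega>\<in>space M. - h * ((1 - \<delta>) * real k) \<le> (\<Sum>j=1..k. - h * X j \<omega>)} =
        space M - {\<omega>\<in>space M. (1 - \<delta>) * real k < S k \<omega>}"
      unfolding sum_distrib_left[symmetric] S_def[symmetric] using h by (auto simp: not_less)
    then have "1 - tail_S k ((1 - \<delta>) * real k) = prob {\<omega>\<in>space M. - h * ((1 - \<delta>) * real k) \<le> (\<Sum>j=1..k. - h * X j \<omega>)}"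
      unfolding tail_S_def by (simp add: prob_compl)
    also have "\<dots> \<le> exp (- (- h * ((1 - \<delta>) * real k))) * expectation (\<lambda>\<omega>. exp (- h * R \<omega>)) ^ k"
      by (intro chernoff i) auto
    also have "\<dots> \<le> exp (- (- h * ((1 - \<delta>) * real k))) * exp (h * \<delta> / 2 - h) ^ k"
      using E by (intro mult_left_mono power_mono) (auto intro!: integral_nonneg_AE)
    also have "\<dots> = exp (- (h * \<delta> / 2) * real k)"
      by (simp only: exp_of_nat_mult[symmetric] exp_add[symmetric]) (simp add: algebra_simps)
    finally show ?thesis by simp
  qed
  moreover have "h * \<delta> / 2 > 0" using h \<delta> by simp
  ultimately show ?thesis by blast
qed

end

end

section \<open>Truncated powers and moments\<close>

lemma subadditive_powr:
  fixes u v \<gamma> :: real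
  assumes "0 \<le> u" "0 \<le> v" "0 \<le> \<gamma>" "\<gamma> \<le> 1"
  shows "(u + v) powr \<gamma> \<le> u powr \<gamma> + v powr \<gamma>"
proof (cases "u + v = 0")
  case False
  then have s: "u + v > 0" using assms by simp
  have part: "w * (u + v) powr \<gamma> / (u + v) \<le> w powr \<gamma>" if "0 \<le> w" "w \<le> u + v" for w
  proof (cases "w = 0")
    case False
    have "(w / (u + v)) powr 1 \<le> (w / (u + v)) powr \<gamma>"
      using that False s assms by (intro powr_mono') auto
    then have "w / (u + v) * (u + v) powr \<gamma> \<le> w powr \<gamma> / (u + v) powr \<gamma> * (u + v) powr \<gamma>"
      using that s by (intro mult_right_mono) (auto simp: powr_divide)
    then show ?thesis using s by simp
  qed simp
  have "(u + v) powr \<gamma> = u * (u + v) powr \<gamma> / (u + v) + v * (u + v) powr \<gamma> / (u + v)"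
    using s by (simp flip: add_divide_distrib distrib_right)
  also have "\<dots> \<le> u powr \<gamma> + v powr \<gamma>" using assms by (intro add_mono part) auto
  finally show ?thesis .
qed (use assms in auto)

lemma powr_le_tangent:
  fixes u k \<gamma> :: real
  assumes "0 \<le> u" "0 < k" "0 \<le> \<gamma>" "\<gamma> \<le> 1"
  shows "u powr \<gamma> \<le> k powr \<gamma> + k powr (\<gamma> - 1) * u"
proof (cases "u \<le> k")
  case True
  then have "u powr \<gamma> \<le> k powr \<gamma>" using assms by (intro powr_mono2) auto
  then show ?thesis using assms by (simp add: add_increasing2)
next
  case False
  have "u powr \<gamma> = u powr (\<gamma> - 1) * u" using False assms powr_add[of u "\<gamma> - 1" 1] by simp
  also have "u powr (\<gamma> - 1) \<le> k powr (\<gamma> - 1)" using False assms by (intro powr_mono2') auto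
  finally show ?thesis using assms by (simp add: add_increasing mult_right_mono)
qed

text \<open>
  A substitute for \<open>u powr (1 + \<gamma>)\<close> that grows only linearly beyond \<open>t\<close>, so that it is
  integrable against any law with finite mean.
\<close>

definition trunc_powr :: "real \<Rightarrow> real \<Rightarrow> real \<Rightarrow> real" where
  "trunc_powr \<gamma> t u = u * min u t powr \<gamma>"

lemma trunc_powr_measurable [measurable]: "trunc_powr \<gamma> t \<in> borel_measurable borel"
  unfolding trunc_powr_def by measurable

text \<open>
  Writing the first factor of \<open>trunc_powr\<close> as a sum and splitting the second one, by subadditivity, at
  the same index \<open>i\<close> leaves the truncated powers of the summands with the coefficient \<open>a\<close>,
  which is what a contraction argument needs, and terms that involve only products of two different
  summands and the sum itself.  Those have expectations known from the means.
\<close>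

lemma trunc_powr_affine_sum:
  fixes x :: "nat \<Rightarrow> real"
  assumes x: "\<And>j. j \<in> J \<Longrightarrow> 0 \<le> x j" and J: "finite J" and a: "0 \<le> a" "a \<le> 1" and b: "0 \<le> b" "b \<le> 1"
    and \<gamma>: "0 < \<gamma>" "\<gamma> \<le> 1" and t: "0 < t"
  defines "k \<equiv> real (card J)"
  shows "trunc_powr \<gamma> t (a * (\<Sum>j\<in>J. x j) + b)
     \<le> a * (\<Sum>i\<in>J. trunc_powr \<gamma> t (x i)) + (k powr \<gamma> + 2) * (\<Sum>i\<in>J. x i)
        + k powr (\<gamma> - 1) * (\<Sum>i\<in>J. \<Sum>j\<in>J - {i}. x i * x j) + 2"
proof -
  define s where "s = (\<Sum>j\<in>J. x j)"
  define m where "m = min (a * s + b) t powr \<gamma>"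
  have s: "s \<ge> 0" unfolding s_def using x by (intro sum_nonneg)
  have m: "m \<ge> 0" by (simp add: m_def)
  have "m \<le> (a * s + b) powr \<gamma>" unfolding m_def using s a b t \<gamma> by (intro powr_mono2) auto
  also have "\<dots> \<le> 1 powr \<gamma> + 1 powr (\<gamma> - 1) * (a * s + b)"
    using s a b \<gamma> by (intro powr_le_tangent) auto
  also have "\<dots> \<le> s + 2" using mult_right_mono[OF a(2) s] b by simp
  finally have m2: "m \<le> s + 2" .
  have summand: "a * x i * m \<le> a * trunc_powr \<gamma> t (x i) + (k powr \<gamma> + 1) * x i
      + k powr (\<gamma> - 1) * (\<Sum>j\<in>J - {i}. x i * x j)" if i: "i \<in> J" for i
  proof -
    define r where "r = (\<Sum>j\<in>J - {i}. x j)"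
    have r: "r \<ge> 0" unfolding r_def using x by (intro sum_nonneg) auto
    have xi: "x i \<ge> 0" using x[OF i] .
    have k: "k > 0" using i J by (auto simp: k_def card_gt_0_iff)
    have sr: "s = x i + r" unfolding s_def r_def using i J by (rule sum.remove[rotated])
    have "m \<le> (min (x i) t + (r + 1)) powr \<gamma>"
      unfolding m_def
    proof (rule powr_mono2)
      have "a * s + b \<le> s + 1" using mult_right_mono[OF a(2) s] b by simp
      then show "min (a * s + b) t \<le> min (x i) t + (r + 1)" using r t by (auto simp: sr min_def)
      show "0 \<le> min (a * s + b) t" using s a b t by auto
    qed (use \<gamma> in auto)
    also have "\<dots> \<le> min (x i) t powr \<gamma> + (r + 1) powr \<gamma>"
      using xi t r \<gamma> by (intro subadditive_powr) auto
    also have "(r + 1) powr \<gamma> \<le> r powr \<gamma> + 1 powr \<gamma>" using r \<gamma> by (intro subadditive_powr) auto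
    also have "r powr \<gamma> \<le> k powr \<gamma> + k powr (\<gamma> - 1) * r" using r k \<gamma> by (intro powr_le_tangent) auto
    finally have "m \<le> min (x i) t powr \<gamma> + (k powr \<gamma> + k powr (\<gamma> - 1) * r + 1)" by simp
    then have "a * x i * m \<le> a * x i * (min (x i) t powr \<gamma> + (k powr \<gamma> + k powr (\<gamma> - 1) * r + 1))"
      using a xi by (intro mult_left_mono) auto
    also have "\<dots> = a * (x i * min (x i) t powr \<gamma>) + a * (x i * (k powr \<gamma> + k powr (\<gamma> - 1) * r + 1))"
      by (simp add: algebra_simps)
    also have "a * (x i * (k powr \<gamma> + k powr (\<gamma> - 1) * r + 1)) \<le> 1 * (x i * (k powr \<gamma> + k powr (\<gamma> - 1) * r + 1))"
      using a xi r by (intro mult_right_mono) (auto intro!: add_nonneg_nonneg mult_nonneg_nonneg)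
    finally show ?thesis
      by (simp add: trunc_powr_def r_def sum_distrib_left algebra_simps)
  qed
  have "trunc_powr \<gamma> t (a * s + b) = (\<Sum>i\<in>J. a * x i * m) + b * m"
    by (simp add: trunc_powr_def m_def s_def sum_distrib_left sum_distrib_right algebra_simps)
  also have "\<dots> \<le> (\<Sum>i\<in>J. a * trunc_powr \<gamma> t (x i) + (k powr \<gamma> + 1) * x i
      + k powr (\<gamma> - 1) * (\<Sum>j\<in>J - {i}. x i * x j)) + 1 * (s + 2)"
    using b m m2 by (intro add_mono sum_mono summand mult_mono) auto
  also have "\<dots> = a * (\<Sum>i\<in>J. trunc_powr \<gamma> t (x i)) + (k powr \<gamma> + 1) * s
        + k powr (\<gamma> - 1) * (\<Sum>i\<in>J. \<Sum>j\<in>J - {i}. x i * x j) + 1 * (s + 2)"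
    by (simp only: sum.distrib sum_distrib_left[symmetric] s_def)
  finally show ?thesis unfolding s_def by (simp add: algebra_simps)
qed

text \<open>On the dyadic shells \<open>{2 ^ n \<le> Y < 2 ^ Suc n}\<close> the moment is compared with a geometric series.\<close>

lemma (in prob_space) integrable_powr_of_tail:
  fixes Y :: "'a \<Rightarrow> real"
  assumes [measurable]: "Y \<in> borel_measurable M" and nonneg: "\<And>\<omega>. \<omega> \<in> space M \<Longrightarrow> 0 \<le> Y \<omega>"
    and p: "0 < p" "p < r"
    and tail: "\<forall>\<^sub>F y in at_top. prob {\<omega>\<in>space M. y < Y \<omega>} \<le> C * y powr (- r)"
  shows "integrable M (\<lambda>\<omega>. Y \<omega> powr p)"
proof -
  define A where "A n = {\<omega>\<in>space M. 2 ^ n / 2 < Y \<omega>}" for n :: nat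
  define w where "w n = (2 ^ Suc n :: real) powr p" for n
  have [measurable]: "A n \<in> events" for n by (simp add: A_def)
  have "filterlim (\<lambda>n. 2 ^ n / 2 :: real) at_top sequentially" by real_asymp
  then have "\<forall>\<^sub>F n in sequentially. prob (A n) \<le> C * (2 ^ n / 2) powr (- r)"
    unfolding A_def using tail by (rule eventually_compose_filterlim[rotated])
  then have "\<forall>\<^sub>F n in sequentially. norm (w n * prob (A n)) \<le> C * (2 powr p * 2 powr r) * (2 powr (p - r)) ^ n"
  proof eventually_elim
    case (elim n)
    have w: "w n = 2 powr p * 2 powr (p * real n)"
      unfolding w_def by (simp add: powr_mult powr_powr mult.commute flip: powr_realpow)
    have half: "(2 ^ n / 2 :: real) powr (- r) = 2 powr r * 2 powr (- r * real n)"
      by (simp add: powr_divide powr_powr powr_minus divide_simps mult.commute flip: powr_realpow)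
    have "norm (w n * prob (A n)) = w n * prob (A n)" by (simp add: w_def)
    also have "\<dots> \<le> w n * (C * (2 ^ n / 2) powr (- r))"
      using elim by (simp add: w_def mult_left_mono)
    also have "\<dots> = 2 powr p * 2 powr (p * real n) * (C * (2 powr r * 2 powr (- r * real n)))"
      by (simp only: w half)
    also have "2 powr p * 2 powr (p * real n) * (C * (2 powr r * 2 powr (- r * real n)))
        = C * (2 powr p * 2 powr r) * (2 powr (p * real n) * 2 powr (- r * real n))"
      by (simp only: mult_ac)
    also have "2 powr (p * real n) * 2 powr (- r * real n) = (2 powr (p - r)) ^ n"
      by (simp add: powr_add[symmetric] powr_powr algebra_simps flip: powr_realpow)
    finally show ?case .
  qed
  moreover have "summable (\<lambda>n. C * (2 powr p * 2 powr r) * (2 powr (p - r)) ^ n)"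
    using p powr_less_mono[of "p - r" 0 2] by (intro summable_mult summable_geometric) auto
  ultimately have sum: "summable (\<lambda>n. w n * prob (A n))" by (rule summable_comparison_test_ev)
  have pw: "ennreal (Y \<omega> powr p) \<le> 1 + (\<Sum>n. ennreal (w n) * indicator (A n) \<omega>)" if \<omega>: "\<omega> \<in> space M" for \<omega>
  proof (cases "1 \<le> Y \<omega>")
    case False
    then have "Y \<omega> powr p \<le> 1 powr p" using nonneg[OF \<omega>] p by (intro powr_mono2) auto
    then have "ennreal (Y \<omega> powr p) \<le> 1" by (simp add: ennreal_le_1)
    then show ?thesis by (rule order_trans) simp
  next
    case True
    then obtain n where n: "2 ^ n \<le> Y \<omega>" "Y \<omega> < 2 ^ Suc n" by (rule dyadic_interval)
    have "(0::real) < 2 ^ n" by simp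
    then have "2 ^ n / 2 < Y \<omega>" using n(1) by linarith
    then have "\<omega> \<in> A n" using \<omega> by (simp add: A_def)
    have "Y \<omega> powr p \<le> w n" unfolding w_def using n nonneg[OF \<omega>] p by (intro powr_mono2) auto
    then have "ennreal (Y \<omega> powr p) \<le> ennreal (w n) * indicator (A n) \<omega>"
      using \<open>\<omega> \<in> A n\<close> by (simp add: ennreal_leI)
    also have "\<dots> \<le> (\<Sum>n. ennreal (w n) * indicator (A n) \<omega>)"
    proof -
      define f where "f n = ennreal (w n) * indicator (A n) \<omega>" for n
      have "sum f {n} \<le> suminf f" by (rule sum_le_suminf) auto
      then show ?thesis by (simp add: f_def[symmetric])
    qed
    finally show ?thesis by (rule order_trans) simp
  qed
  have "(\<integral>\<^sup>+\<omega>. ennreal (Y \<omega> powr p) \<partial>M) \<le> (\<integral>\<^sup>+\<omega>. 1 + (\<Sum>n. ennreal (w n) * indicator (A n) \<omega>) \<partial>M)"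
    by (intro nn_integral_mono pw)
  also have "\<dots> = 1 + (\<Sum>n. ennreal (w n) * emeasure M (A n))"
    by (simp add: nn_integral_add nn_integral_suminf nn_integral_cmult_indicator emeasure_space_1)
  also have "(\<Sum>n. ennreal (w n) * emeasure M (A n)) = (\<Sum>n. ennreal (w n * prob (A n)))"
    by (simp add: emeasure_eq_measure ennreal_mult' w_def)
  also have "\<dots> = ennreal (\<Sum>n. w n * prob (A n))"
    using sum by (intro suminf_ennreal2) (auto simp: w_def)
  also have "1 + \<dots> < \<infinity>" by (simp add: ennreal_add_eq_top less_top[symmetric])
  finally show ?thesis by (intro integrableI_nonneg) auto
qed

section \<open>The fixed-point equation\<close>

text \<open>
  The independence of \<open>K\<close> and the sequence \<open>X\<close> enters only through the partial sums, one at a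
  time.  The Out-Degree is a real number here, to avoid coercions.
\<close>

locale random_sum_fixpoint = iid_nonneg M R X for M :: "'a measure" and R X +
  fixes K :: "'a \<Rightarrow> nat" and c d :: real
  assumes K_measurable [measurable]: "K \<in> measurable M (count_space UNIV)"
    and c: "0 < c" "c < 1" and d: "1 \<le> d"
    and K_indep: "\<And>k B. B \<in> sets borel \<Longrightarrow>
      prob {\<omega>\<in>space M. K \<omega> = k \<and> S k \<omega> \<in> B} = prob {\<omega>\<in>space M. K \<omega> = k} * prob {\<omega>\<in>space M. S k \<omega> \<in> B}"
    and fixpoint: "distr M borel R = distr M borel (\<lambda>\<omega>. c / d * S (K \<omega>) \<omega> + (1 - c))"
begin

definition tail_K :: "real \<Rightarrow> real" where "tail_K y = prob {\<omega>\<in>space M. y < real (K \<omega>)}"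

lemma tail_K_antimono: "x \<le> y \<Longrightarrow> tail_K y \<le> tail_K x"
  unfolding tail_K_def by (intro finite_measure_mono) auto

lemma random_sum_measurable [measurable]: "(\<lambda>\<omega>. S (K \<omega>) \<omega>) \<in> borel_measurable M"
  by (rule measurable_compose_countable[OF S_measurable K_measurable])

lemma nn_integral_on_K_eq:
  assumes [measurable]: "\<phi> \<in> borel_measurable borel"
  shows "(\<integral>\<^sup>+\<omega>. \<phi> (S k \<omega>) * indicator {\<omega>\<in>space M. K \<omega> = k} \<omega> \<partial>M)
       = emeasure M {\<omega>\<in>space M. K \<omega> = k} * (\<integral>\<^sup>+\<omega>. \<phi> (S k \<omega>) \<partial>M)"
proof -
  define A where "A = {\<omega>\<in>space M. K \<omega> = k}"
  have A [measurable]: "A \<in> events" by (simp add: A_def)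
  have "distr (density M (indicator A)) borel (S k) = scale_measure (emeasure M A) (distr M borel (S k))"
  proof (rule measure_eqI)
    fix B assume "B \<in> sets (distr (density M (indicator A)) borel (S k))"
    then have B [measurable]: "B \<in> sets borel" by simp
    have "emeasure (distr (density M (indicator A)) borel (S k)) B
        = emeasure (density M (indicator A)) (S k -` B \<inter> space M)"
      by (subst emeasure_distr) auto
    also have "\<dots> = (\<integral>\<^sup>+\<omega>. indicator A \<omega> * indicator (S k -` B \<inter> space M) \<omega> \<partial>M)"
      by (subst emeasure_density) auto
    also have "\<dots> = (\<integral>\<^sup>+\<omega>. indicator (A \<inter> (S k -` B \<inter> space M)) \<omega> \<partial>M)"
      by (simp add: indicator_inter_arith)
    also have "\<dots> = emeasure M (A \<inter> (S k -` B \<inter> space M))" by simp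
    also have "A \<inter> (S k -` B \<inter> space M) = {\<omega>\<in>space M. K \<omega> = k \<and> S k \<omega> \<in> B}"
      by (auto simp: A_def)
    also have "emeasure M \<dots> = emeasure M A * emeasure M (S k -` B \<inter> space M)"
      using K_indep[OF B, of k]
      by (simp add: emeasure_eq_measure A_def ennreal_mult' vimage_def Int_def conj_commute)
    also have "\<dots> = emeasure (scale_measure (emeasure M A) (distr M borel (S k))) B"
      by (simp add: emeasure_distr)
    finally show "emeasure (distr (density M (indicator A)) borel (S k)) B
      = emeasure (scale_measure (emeasure M A) (distr M borel (S k))) B" .
  qed simp
  then have "nn_integral (distr (density M (indicator A)) borel (S k)) \<phi>
      = nn_integral (scale_measure (emeasure M A) (distr M borel (S k))) \<phi>" by simp
  then have "(\<integral>\<^sup>+\<omega>. indicator A \<omega> * \<phi> (S k \<omega>) \<partial>M) = emeasure M A * (\<integral>\<^sup>+\<omega>. \<phi> (S k \<omega>) \<partial>M)"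
    by (simp add: nn_integral_distr nn_integral_density nn_integral_scale_measure)
  then show ?thesis by (simp add: A_def mult.commute)
qed

lemma nn_integral_random_sum:
  assumes [measurable]: "\<phi> \<in> borel_measurable borel"
  shows "(\<integral>\<^sup>+\<omega>. \<phi> (S (K \<omega>) \<omega>) \<partial>M) = (\<integral>\<^sup>+\<omega>. (\<integral>\<^sup>+\<omega>'. \<phi> (S (K \<omega>) \<omega>') \<partial>M) \<partial>M)"
proof -
  define A where "A k = {\<omega>\<in>space M. K \<omega> = k}" for k
  have A [measurable]: "A k \<in> events" for k by (simp add: A_def)
  have split: "f (K \<omega>) = (\<Sum>k. f k * indicator (A k) \<omega>)" if "\<omega> \<in> space M" for f :: "nat \<Rightarrow> ennreal" and \<omega>
    using suminf_finite[of "{K \<omega>}" "\<lambda>k. f k * indicator (A k) \<omega>"] that by (auto simp: A_def)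
  have "(\<integral>\<^sup>+\<omega>. \<phi> (S (K \<omega>) \<omega>) \<partial>M) = (\<integral>\<^sup>+\<omega>. (\<Sum>k. \<phi> (S k \<omega>) * indicator (A k) \<omega>) \<partial>M)"
  proof (rule nn_integral_cong)
    fix \<omega> assume "\<omega> \<in> space M"
    from split[OF this, of "\<lambda>k. \<phi> (S k \<omega>)"]
    show "\<phi> (S (K \<omega>) \<omega>) = (\<Sum>k. \<phi> (S k \<omega>) * indicator (A k) \<omega>)" .
  qed
  also have "\<dots> = (\<Sum>k. \<integral>\<^sup>+\<omega>. \<phi> (S k \<omega>) * indicator (A k) \<omega> \<partial>M)"
    by (intro nn_integral_suminf) simp
  also have "\<dots> = (\<Sum>k. emeasure M (A k) * (\<integral>\<^sup>+\<omega>. \<phi> (S k \<omega>) \<partial>M))"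
    unfolding A_def by (simp add: nn_integral_on_K_eq)
  also have "\<dots> = (\<Sum>k. \<integral>\<^sup>+\<omega>. (\<integral>\<^sup>+\<omega>'. \<phi> (S k \<omega>') \<partial>M) * indicator (A k) \<omega> \<partial>M)"
    by (simp add: nn_integral_cmult_indicator) (simp add: mult.commute)
  also have "\<dots> = (\<integral>\<^sup>+\<omega>. (\<Sum>k. (\<integral>\<^sup>+\<omega>'. \<phi> (S k \<omega>') \<partial>M) * indicator (A k) \<omega>) \<partial>M)"
    by (intro nn_integral_suminf[symmetric]) simp
  also have "\<dots> = (\<integral>\<^sup>+\<omega>. (\<integral>\<^sup>+\<omega>'. \<phi> (S (K \<omega>) \<omega>') \<partial>M) \<partial>M)"
    by (intro nn_integral_cong split[symmetric])
  finally show ?thesis .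
qed

lemma nn_integral_fixpoint:
  assumes [measurable]: "\<phi> \<in> borel_measurable borel"
  shows "(\<integral>\<^sup>+\<omega>. \<phi> (R \<omega>) \<partial>M) = (\<integral>\<^sup>+\<omega>. (\<integral>\<^sup>+\<omega>'. \<phi> (c / d * S (K \<omega>) \<omega>' + (1 - c)) \<partial>M) \<partial>M)"
proof -
  have "(\<integral>\<^sup>+\<omega>. \<phi> (R \<omega>) \<partial>M) = nn_integral (distr M borel R) \<phi>" by (simp add: nn_integral_distr)
  also have "\<dots> = (\<integral>\<^sup>+\<omega>. \<phi> (c / d * S (K \<omega>) \<omega> + (1 - c)) \<partial>M)"
    unfolding fixpoint by (simp add: nn_integral_distr)
  also have "\<dots> = (\<integral>\<^sup>+\<omega>. (\<integral>\<^sup>+\<omega>'. \<phi> (c / d * S (K \<omega>) \<omega>' + (1 - c)) \<partial>M) \<partial>M)"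
    by (rule nn_integral_random_sum[of "\<lambda>y. \<phi> (c / d * y + (1 - c))"]) simp
  finally show ?thesis .
qed

lemma tail_R_fixpoint: "tail_R (c / d * x + (1 - c)) = expectation (\<lambda>\<omega>. tail_S (K \<omega>) x)"
proof -
  have cd: "c / d > 0" using c d by simp
  have "ennreal (tail_R (c / d * x + (1 - c))) = (\<integral>\<^sup>+\<omega>. indicator {c / d * x + (1 - c)<..} (R \<omega>) \<partial>M)"
  proof -
    have "(\<integral>\<^sup>+\<omega>. indicator {c / d * x + (1 - c)<..} (R \<omega>) \<partial>M)
        = (\<integral>\<^sup>+\<omega>. indicator {\<omega>\<in>space M. c / d * x + (1 - c) < R \<omega>} \<omega> \<partial>M)"
      by (intro nn_integral_cong) (auto simp: indicator_def)
    then show ?thesis by (simp add: tail_R_def emeasure_eq_measure)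
  qed
  also have "\<dots> = (\<integral>\<^sup>+\<omega>. (\<integral>\<^sup>+\<omega>'. indicator {c / d * x + (1 - c)<..} (c / d * S (K \<omega>) \<omega>' + (1 - c)) \<partial>M) \<partial>M)"
    by (rule nn_integral_fixpoint) simp
  also have "\<dots> = (\<integral>\<^sup>+\<omega>. ennreal (tail_S (K \<omega>) x) \<partial>M)"
  proof (rule nn_integral_cong)
    fix \<omega>
    have "(\<integral>\<^sup>+\<omega>'. indicator {c / d * x + (1 - c)<..} (c / d * S (K \<omega>) \<omega>' + (1 - c)) \<partial>M)
        = (\<integral>\<^sup>+\<omega>'. indicator {\<omega>'\<in>space M. x < S (K \<omega>) \<omega>'} \<omega>' \<partial>M)"
      using mult_less_cancel_left_pos[OF cd] by (intro nn_integral_cong) (auto simp: indicator_def simp del: times_divide_eq_left)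
    then show "(\<integral>\<^sup>+\<omega>'. indicator {c / d * x + (1 - c)<..} (c / d * S (K \<omega>) \<omega>' + (1 - c)) \<partial>M) = ennreal (tail_S (K \<omega>) x)"
      by (simp add: tail_S_def emeasure_eq_measure)
  qed
  also have "\<dots> = ennreal (expectation (\<lambda>\<omega>. tail_S (K \<omega>) x))"
    by (intro nn_integral_eq_integral integrable_const_bound[where B=1]) (auto simp: tail_S_nonneg tail_S_le_1)
  finally show ?thesis by (simp add: tail_R_nonneg integral_nonneg_AE tail_S_nonneg)
qed

lemma S_nonneg_AE: "AE \<omega> in M. 0 \<le> S k \<omega>"
  using X_nonneg_AE by eventually_elim (auto simp: S_def intro!: sum_nonneg)

lemma X_integrable: "1 \<le> j \<Longrightarrow> integrable M (X j)" and X_mean: "1 \<le> j \<Longrightarrow> expectation (X j) = 1"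
  using expectation_X[of j "\<lambda>x. x"] R_integrable R_mean by auto

lemma S_mean: "integrable M (S k)" "expectation (S k) = real k"
proof -
  show "integrable M (S k)" unfolding S_def by (intro Bochner_Integration.integrable_sum X_integrable) auto
  have "expectation (S k) = (\<Sum>j=1..k. expectation (X j))"
    unfolding S_def by (intro Bochner_Integration.integral_sum X_integrable) auto
  then show "expectation (S k) = real k" by (simp add: X_mean)
qed

lemma nn_integral_affine_S:
  assumes "0 \<le> a" "0 \<le> b"
  shows "(\<integral>\<^sup>+\<omega>. ennreal (a * S k \<omega> + b) \<partial>M) = ennreal (a * real k + b)"
proof -
  have "(\<integral>\<^sup>+\<omega>. ennreal (a * S k \<omega> + b) \<partial>M) = ennreal (expectation (\<lambda>\<omega>. a * S k \<omega> + b))"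
  proof (rule nn_integral_eq_integral)
    show "AE \<omega> in M. 0 \<le> a * S k \<omega> + b" using S_nonneg_AE[of k] by eventually_elim (use assms in auto)
  qed (use S_mean in auto)
  then show ?thesis using S_mean by (simp add: prob_space)
qed

text \<open>Taking expectations in the fixed-point equation, where \<open>E R = 1\<close>, determines the mean of \<open>K\<close>.\<close>

lemma K_mean: "integrable M (\<lambda>\<omega>. real (K \<omega>))" "expectation (\<lambda>\<omega>. real (K \<omega>)) = d"
proof -
  have cd: "c / d > 0" using c d by simp
  have "ennreal 1 = (\<integral>\<^sup>+\<omega>. ennreal (R \<omega>) \<partial>M)"
    using R_integrable R_nonneg R_mean by (subst nn_integral_eq_integral) auto
  also have "\<dots> = (\<integral>\<^sup>+\<omega>. ennreal (c / d * real (K \<omega>) + (1 - c)) \<partial>M)"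
    using c cd by (simp add: nn_integral_fixpoint nn_integral_affine_S del: times_divide_eq_left)
  finally have 1: "(\<integral>\<^sup>+\<omega>. ennreal (c / d * real (K \<omega>) + (1 - c)) \<partial>M) = ennreal 1" by simp
  have i: "integrable M (\<lambda>\<omega>. c / d * real (K \<omega>) + (1 - c))"
    using c cd 1 by (intro integrableI_nonneg) (auto simp: less_top simp del: times_divide_eq_left)
  then have "integrable M (\<lambda>\<omega>. (c / d * real (K \<omega>) + (1 - c) - (1 - c)) / (c / d))"
    by (intro integrable_divide Bochner_Integration.integrable_diff) auto
  then show int: "integrable M (\<lambda>\<omega>. real (K \<omega>))" using cd c d by simp
  have "ennreal (expectation (\<lambda>\<omega>. c / d * real (K \<omega>) + (1 - c))) = ennreal 1"
    using 1 c cd by (subst nn_integral_eq_integral[OF i, symmetric]) (auto simp del: times_divide_eq_left)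
  then have "expectation (\<lambda>\<omega>. c / d * real (K \<omega>) + (1 - c)) = 1"
    by (simp only: ennreal_1 ennreal_eq_1)
  then have "c / d * expectation (\<lambda>\<omega>. real (K \<omega>)) + (1 - c) = 1"
    using int by (simp add: prob_space del: times_divide_eq_left)
  then show "expectation (\<lambda>\<omega>. real (K \<omega>)) = d" using c d by (simp add: field_simps)
qed

lemma expectation_XX:
  assumes "1 \<le> i" "1 \<le> j" "i \<noteq> j"
  shows "integrable M (\<lambda>\<omega>. X i \<omega> * X j \<omega>)" "expectation (\<lambda>\<omega>. X i \<omega> * X j \<omega>) = 1"
proof -
  have ind: "indep_vars (\<lambda>_. borel) X {i, j}" using assms by (intro indep_vars_subset[OF X_indep]) auto
  have int: "\<And>l. l \<in> {i, j} \<Longrightarrow> integrable M (X l)" using assms X_integrable by auto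
  show "integrable M (\<lambda>\<omega>. X i \<omega> * X j \<omega>)"
    using indep_vars_integrable[OF _ ind int] assms(3) by simp
  show "expectation (\<lambda>\<omega>. X i \<omega> * X j \<omega>) = 1"
    using indep_vars_lebesgue_integral[OF _ ind int] assms by (simp add: X_mean)
qed

lemma integrable_trunc_powr_R:
  assumes "0 < \<gamma>" "0 < t"
  shows "integrable M (\<lambda>\<omega>. trunc_powr \<gamma> t (R \<omega>))"
proof (rule Bochner_Integration.integrable_bound)
  show "integrable M (\<lambda>\<omega>. t powr \<gamma> * R \<omega>)" using R_integrable by simp
  show "AE \<omega> in M. norm (trunc_powr \<gamma> t (R \<omega>)) \<le> norm (t powr \<gamma> * R \<omega>)"
  proof (rule AE_I2)
    fix \<omega> assume "\<omega> \<in> space M"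
    then have "0 \<le> R \<omega>" by (rule R_nonneg)
    then show "norm (trunc_powr \<gamma> t (R \<omega>)) \<le> norm (t powr \<gamma> * R \<omega>)"
      using assms by (auto simp: trunc_powr_def abs_mult mult.commute intro!: mult_left_mono powr_mono2)
  qed
qed simp

lemma nn_integral_trunc_powr_S:
  assumes \<gamma>: "0 < \<gamma>" "\<gamma> \<le> 1" and t: "0 < t"
  shows "(\<integral>\<^sup>+\<omega>. ennreal (trunc_powr \<gamma> t (c / d * S k \<omega> + (1 - c))) \<partial>M)
     \<le> ennreal (c / d * real k * expectation (\<lambda>\<omega>. trunc_powr \<gamma> t (R \<omega>)) + 2 * real k powr (1 + \<gamma>) + 2 * real k + 2)"
proof -
  define G where "G = expectation (\<lambda>\<omega>. trunc_powr \<gamma> t (R \<omega>))"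
  define a where "a = c / d"
  have a: "0 \<le> a" "a \<le> 1" using c d by (auto simp: a_def)
  have intR: "integrable M (\<lambda>\<omega>. trunc_powr \<gamma> t (R \<omega>))"
    using \<gamma> t by (intro integrable_trunc_powr_R) auto
  define B where "B \<omega> = a * (\<Sum>i=1..k. trunc_powr \<gamma> t (X i \<omega>)) + (real k powr \<gamma> + 2) * S k \<omega>
        + real k powr (\<gamma> - 1) * (\<Sum>i=1..k. \<Sum>j\<in>{1..k} - {i}. X i \<omega> * X j \<omega>) + 2" for \<omega>
  have i1: "integrable M (\<lambda>\<omega>. trunc_powr \<gamma> t (X i \<omega>))" "expectation (\<lambda>\<omega>. trunc_powr \<gamma> t (X i \<omega>)) = G"
    if "i \<in> {1..k}" for i using that intR expectation_X[of i "trunc_powr \<gamma> t"] by (auto simp: G_def)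
  have i2: "integrable M (\<lambda>\<omega>. \<Sum>j\<in>{1..k} - {i}. X i \<omega> * X j \<omega>)" if "i \<in> {1..k}" for i
    using that by (intro Bochner_Integration.integrable_sum expectation_XX) auto
  have i3: "expectation (\<lambda>\<omega>. \<Sum>j\<in>{1..k} - {i}. X i \<omega> * X j \<omega>) = real k - 1" if "i \<in> {1..k}" for i
  proof -
    have "expectation (\<lambda>\<omega>. \<Sum>j\<in>{1..k} - {i}. X i \<omega> * X j \<omega>) = (\<Sum>j\<in>{1..k} - {i}. expectation (\<lambda>\<omega>. X i \<omega> * X j \<omega>))"
      using that by (intro Bochner_Integration.integral_sum expectation_XX) auto
    also have "\<dots> = (\<Sum>j\<in>{1..k} - {i}. 1)" using that by (intro sum.cong expectation_XX) auto
    also have "\<dots> = real k - 1" using that by (simp add: card_Diff_singleton_if of_nat_diff)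
    finally show ?thesis .
  qed
  define U where "U \<omega> = (\<Sum>i=1..k. trunc_powr \<gamma> t (X i \<omega>))" for \<omega>
  define W where "W \<omega> = (\<Sum>i=1..k. \<Sum>j\<in>{1..k} - {i}. X i \<omega> * X j \<omega>)" for \<omega>
  have U: "integrable M U" "expectation U = real k * G"
    unfolding U_def using i1 by (auto simp: Bochner_Integration.integral_sum)
  have W: "integrable M W" "expectation W = real k * (real k - 1)"
    unfolding W_def using i2 i3 by (auto simp: Bochner_Integration.integral_sum)
  have B: "B = (\<lambda>\<omega>. a * U \<omega> + (real k powr \<gamma> + 2) * S k \<omega> + real k powr (\<gamma> - 1) * W \<omega> + 2)"
    by (simp add: B_def U_def W_def fun_eq_iff)
  have intB: "integrable M B" unfolding B using U W S_mean by simp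
  have "expectation B = a * (real k * G) + (real k powr \<gamma> + 2) * real k + real k powr (\<gamma> - 1) * (real k * (real k - 1)) + 2"
    unfolding B using U W S_mean by (simp add: prob_space)
  also have "\<dots> \<le> a * real k * G + 2 * real k powr (1 + \<gamma>) + 2 * real k + 2"
  proof (cases "k = 0")
    case False
    have "real k powr (\<gamma> - 1) * (real k * (real k - 1)) \<le> real k powr (\<gamma> - 1) * (real k * real k)"
      by (intro mult_left_mono) auto
    also have "\<dots> = real k powr (1 + \<gamma>)"
      using False powr_add[of "real k" "\<gamma> - 1" 2] by (simp add: power2_eq_square add.commute)
    finally show ?thesis using False powr_add[of "real k" \<gamma> 1] by (simp add: algebra_simps)
  qed auto
  finally have EB: "expectation B \<le> a * real k * G + 2 * real k powr (1 + \<gamma>) + 2 * real k + 2" .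
  have pw: "AE \<omega> in M. 0 \<le> trunc_powr \<gamma> t (a * S k \<omega> + (1 - c)) \<and> trunc_powr \<gamma> t (a * S k \<omega> + (1 - c)) \<le> B \<omega>"
    using X_nonneg_AE
  proof eventually_elim
    case (elim \<omega>)
    have "0 \<le> S k \<omega>" using elim by (auto simp: S_def intro!: sum_nonneg)
    then have "0 \<le> trunc_powr \<gamma> t (a * S k \<omega> + (1 - c))" using a c by (simp add: trunc_powr_def)
    moreover have "trunc_powr \<gamma> t (a * S k \<omega> + (1 - c)) \<le> B \<omega>"
      using trunc_powr_affine_sum[of "{1..k}" "\<lambda>j. X j \<omega>" a "1 - c" \<gamma> t] elim a c \<gamma> t
      by (simp add: B_def S_def)
    ultimately show ?case by simp
  qed
  have "(\<integral>\<^sup>+\<omega>. ennreal (trunc_powr \<gamma> t (a * S k \<omega> + (1 - c))) \<partial>M) \<le> (\<integral>\<^sup>+\<omega>. ennreal (B \<omega>) \<partial>M)"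
    by (rule nn_integral_mono_AE) (use pw in \<open>eventually_elim, auto intro: ennreal_leI\<close>)
  also have "\<dots> = ennreal (expectation B)"
    by (rule nn_integral_eq_integral[OF intB]) (use pw in \<open>eventually_elim, auto\<close>)
  also have "\<dots> \<le> ennreal (a * real k * G + 2 * real k powr (1 + \<gamma>) + 2 * real k + 2)"
    using EB by (rule ennreal_leI)
  finally show ?thesis by (simp add: a_def G_def)
qed

text \<open>
  For the truncated moment \<open>G\<close> of \<open>R\<close>, which is finite, the fixed-point equation gives
  \<open>G \<le> c / d * E K * G + const = c * G + const\<close> with a constant that does not depend on the
  truncation level \<open>t\<close>.  Since \<open>c < 1\<close>, the bound on \<open>G\<close> is uniform, and \<open>t \<rightarrow> \<infinity>\<close> by Fatou's lemma.
\<close>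

lemma R_moment_of_K_moment:
  assumes p: "1 < p" "p \<le> 2" and Kp: "integrable M (\<lambda>\<omega>. real (K \<omega>) powr p)"
  shows "integrable M (\<lambda>\<omega>. R \<omega> powr p)"
proof -
  define \<gamma> where "\<gamma> = p - 1"
  have \<gamma>: "0 < \<gamma>" "\<gamma> \<le> 1" "1 + \<gamma> = p" using p by (auto simp: \<gamma>_def)
  define C where "C = (2 * expectation (\<lambda>\<omega>. real (K \<omega>) powr p) + 2 * d + 2) / (1 - c)"
  have bound: "(\<integral>\<^sup>+\<omega>. ennreal (trunc_powr \<gamma> t (R \<omega>)) \<partial>M) \<le> ennreal C" if t: "t > 0" for t
  proof -
    define G where "G = expectation (\<lambda>\<omega>. trunc_powr \<gamma> t (R \<omega>))"
    have G0: "G \<ge> 0" unfolding G_def using R_nonneg by (intro integral_nonneg_AE AE_I2) (auto simp: trunc_powr_def)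
    have G: "(\<integral>\<^sup>+\<omega>. ennreal (trunc_powr \<gamma> t (R \<omega>)) \<partial>M) = ennreal G"
      unfolding G_def
    proof (rule nn_integral_eq_integral)
      show "integrable M (\<lambda>\<omega>. trunc_powr \<gamma> t (R \<omega>))"
        using \<gamma> t by (intro integrable_trunc_powr_R) auto
    qed (use R_nonneg in \<open>auto simp: trunc_powr_def\<close>)
    have cd: "c / d \<ge> 0" using c d by simp
    have int: "integrable M (\<lambda>\<omega>. c / d * real (K \<omega>) * G + 2 * real (K \<omega>) powr p + 2 * real (K \<omega>) + 2)"
      using K_mean(1) Kp by (intro Bochner_Integration.integrable_add integrable_mult_right integrable_mult_left) auto
    have "ennreal G \<le> (\<integral>\<^sup>+\<omega>. ennreal (c / d * real (K \<omega>) * G + 2 * real (K \<omega>) powr p + 2 * real (K \<omega>) + 2) \<partial>M)"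
      unfolding G[symmetric] 
      by (subst nn_integral_fixpoint, simp, rule nn_integral_mono)
         (use nn_integral_trunc_powr_S[OF \<gamma>(1,2) t] in \<open>simp only: \<gamma> G_def\<close>)
    also have "\<dots> = ennreal (expectation (\<lambda>\<omega>. c / d * real (K \<omega>) * G + 2 * real (K \<omega>) powr p + 2 * real (K \<omega>) + 2))"
      using G0 cd by (intro nn_integral_eq_integral int AE_I2) (simp del: times_divide_eq_left)
    also have "expectation (\<lambda>\<omega>. c / d * real (K \<omega>) * G + 2 * real (K \<omega>) powr p + 2 * real (K \<omega>) + 2)
        = c / d * expectation (\<lambda>\<omega>. real (K \<omega>)) * G + 2 * expectation (\<lambda>\<omega>. real (K \<omega>) powr p) + 2 * expectation (\<lambda>\<omega>. real (K \<omega>)) + 2"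
      using K_mean(1) Kp by (simp add: prob_space)
    also have "\<dots> = c * G + (2 * expectation (\<lambda>\<omega>. real (K \<omega>) powr p) + 2 * d + 2)"
      using d by (simp add: K_mean)
    finally have "ennreal G \<le> ennreal (c * G + (2 * expectation (\<lambda>\<omega>. real (K \<omega>) powr p) + 2 * d + 2))" .
    moreover have "0 \<le> c * G + (2 * expectation (\<lambda>\<omega>. real (K \<omega>) powr p) + 2 * d + 2)"
      using G0 c d by (intro add_nonneg_nonneg mult_nonneg_nonneg integral_nonneg_AE) auto
    ultimately have "G \<le> c * G + (2 * expectation (\<lambda>\<omega>. real (K \<omega>) powr p) + 2 * d + 2)" by simp
    then have "G * (1 - c) \<le> 2 * expectation (\<lambda>\<omega>. real (K \<omega>) powr p) + 2 * d + 2" by (simp add: algebra_simps)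
    then have "G \<le> C" using c by (simp add: C_def pos_le_divide_eq)
    then show ?thesis unfolding G by (rule ennreal_leI)
  qed
  have lim: "(\<lambda>n. ennreal (trunc_powr \<gamma> (real (Suc n)) (R \<omega>))) \<longlonglongrightarrow> ennreal (R \<omega> powr p)"
    if "\<omega> \<in> space M" for \<omega>
  proof (rule tendsto_eventually, rule eventually_sequentiallyI)
    fix n assume "nat \<lceil>R \<omega>\<rceil> \<le> n"
    then have "min (R \<omega>) (real (Suc n)) = R \<omega>" by linarith
    moreover have "R \<omega> * R \<omega> powr \<gamma> = R \<omega> powr p"
      using R_nonneg[OF that] powr_add[of "R \<omega>" 1 \<gamma>] \<gamma> by (cases "R \<omega> = 0") auto
    ultimately show "ennreal (trunc_powr \<gamma> (real (Suc n)) (R \<omega>)) = ennreal (R \<omega> powr p)"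
      by (simp add: trunc_powr_def)
  qed
  have "(\<integral>\<^sup>+\<omega>. ennreal (R \<omega> powr p) \<partial>M)
      = (\<integral>\<^sup>+\<omega>. liminf (\<lambda>n. ennreal (trunc_powr \<gamma> (real (Suc n)) (R \<omega>))) \<partial>M)"
    by (intro nn_integral_cong lim_imp_Liminf[symmetric] lim) auto
  also have "\<dots> \<le> liminf (\<lambda>n. \<integral>\<^sup>+\<omega>. ennreal (trunc_powr \<gamma> (real (Suc n)) (R \<omega>)) \<partial>M)"
    by (intro nn_integral_liminf) auto
  also have "\<dots> \<le> liminf (\<lambda>n. ennreal C)"
    by (intro Liminf_mono always_eventually allI bound) auto
  also have "\<dots> = ennreal C" by (simp add: Liminf_const)
  finally have "(\<integral>\<^sup>+\<omega>. ennreal (R \<omega> powr p) \<partial>M) \<le> ennreal C" .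
  then show ?thesis by (intro integrableI_nonneg) (auto intro: le_less_trans)
qed

end

section \<open>Two-sided bounds for the tail\<close>

context random_sum_fixpoint
begin

text \<open>The expectation of \<open>K\<close> on the event \<open>K > w\<close>, not the conditional expectation.\<close>

definition K_mean_above :: "real \<Rightarrow> real" where
  "K_mean_above w = expectation (\<lambda>\<omega>. real (K \<omega>) * indicator {w<..} (real (K \<omega>)))"

lemma integrable_K_tail: "integrable M (\<lambda>\<omega>. real (K \<omega>) * indicator {w<..} (real (K \<omega>)))"
  by (rule Bochner_Integration.integrable_bound[OF K_mean(1)]) (auto simp: indicator_def)

lemma K_mean_above_nonneg: "0 \<le> K_mean_above w"
  unfolding K_mean_above_def by (intro integral_nonneg_AE) auto

lemma K_mean_above_tendsto_0: "(K_mean_above \<longlongrightarrow> 0) at_top"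
proof -
  have "((\<lambda>w. expectation (\<lambda>\<omega>. real (K \<omega>) * indicator {w<..} (real (K \<omega>)))) \<longlongrightarrow> expectation (\<lambda>_. 0)) at_top"
  proof (rule integral_dominated_convergence_at_top)
    show "AE \<omega> in M. ((\<lambda>w. real (K \<omega>) * indicator {w<..} (real (K \<omega>))) \<longlongrightarrow> 0) at_top"
    proof (rule AE_I2, rule tendsto_eventually)
      fix \<omega>
      show "\<forall>\<^sub>F w in at_top. real (K \<omega>) * indicator {w<..} (real (K \<omega>)) = 0"
        using eventually_ge_at_top[of "real (K \<omega>)"] by eventually_elim (auto simp: indicator_def)
    qed
    show "integrable M (\<lambda>\<omega>. real (K \<omega>))" by (rule K_mean)
  qed (auto simp: indicator_def)
  then show ?thesis by (simp add: K_mean_above_def[abs_def])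
qed

lemma expectation_indicator_K: "expectation (\<lambda>\<omega>. indicator {w<..} (real (K \<omega>))) = tail_K w"
proof -
  have "expectation (\<lambda>\<omega>. indicator {w<..} (real (K \<omega>))) = expectation (indicator {\<omega>\<in>space M. w < real (K \<omega>)} :: _ \<Rightarrow> real)"
    by (intro Bochner_Integration.integral_cong) (auto simp: indicator_def)
  then show ?thesis by (simp add: tail_K_def)
qed

lemma expectation_of_K_combination:
  "integrable M (\<lambda>\<omega>. A0 * indicator {z<..} (real (K \<omega>)) + A1 * real (K \<omega>)
     + A2 * (real (K \<omega>) * indicator {w<..} (real (K \<omega>))) + A3)"
  "expectation (\<lambda>\<omega>. A0 * indicator {z<..} (real (K \<omega>)) + A1 * real (K \<omega>)
     + A2 * (real (K \<omega>) * indicator {w<..} (real (K \<omega>))) + A3) = A0 * tail_K z + A1 * d + A2 * K_mean_above w + A3"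
proof -
  have i: "integrable M (\<lambda>\<omega>. indicator {z<..} (real (K \<omega>)) :: real)"
    by (intro integrable_const_bound[where B=1]) (auto simp: indicator_def)
  show "integrable M (\<lambda>\<omega>. A0 * indicator {z<..} (real (K \<omega>)) + A1 * real (K \<omega>)
     + A2 * (real (K \<omega>) * indicator {w<..} (real (K \<omega>))) + A3)"
    by (intro Bochner_Integration.integrable_add integrable_mult_right i K_mean integrable_K_tail integrable_const)
  have "expectation (\<lambda>\<omega>. A0 * indicator {z<..} (real (K \<omega>)) + A1 * real (K \<omega>)
     + A2 * (real (K \<omega>) * indicator {w<..} (real (K \<omega>))) + A3)
     = expectation (\<lambda>\<omega>. A0 * indicator {z<..} (real (K \<omega>))) + expectation (\<lambda>\<omega>. A1 * real (K \<omega>))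
     + expectation (\<lambda>\<omega>. A2 * (real (K \<omega>) * indicator {w<..} (real (K \<omega>)))) + A3"
    using i K_mean(1) integrable_K_tail[of w]
    by (subst Bochner_Integration.integral_add, (simp; fail), (simp; fail))+ (simp add: prob_space)
  then show "expectation (\<lambda>\<omega>. A0 * indicator {z<..} (real (K \<omega>)) + A1 * real (K \<omega>)
     + A2 * (real (K \<omega>) * indicator {w<..} (real (K \<omega>))) + A3) = A0 * tail_K z + A1 * d + A2 * K_mean_above w + A3"
    by (simp add: expectation_indicator_K K_mean K_mean_above_def)
qed

lemma tail_S_K_integrable: "integrable M (\<lambda>\<omega>. tail_S (K \<omega>) x)"
  by (intro integrable_const_bound[where B=1]) (auto simp: tail_S_nonneg tail_S_le_1)

lemma tail_R_fixpoint_le: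
  assumes "\<And>k. tail_S k x \<le> A0 * indicator {z<..} (real k) + A1 * real k + A2 * (real k * indicator {w<..} (real k)) + A3"
  shows "tail_R (c / d * x + (1 - c)) \<le> A0 * tail_K z + A1 * d + A2 * K_mean_above w + A3"
  unfolding tail_R_fixpoint expectation_of_K_combination(2)[symmetric]
  by (intro integral_mono tail_S_K_integrable expectation_of_K_combination(1) assms)

lemma tail_R_fixpoint_ge:
  assumes "\<And>k. A0 * indicator {z<..} (real k) + A1 * real k + A2 * (real k * indicator {w<..} (real k)) + A3 \<le> tail_S k x"
  shows "A0 * tail_K z + A1 * d + A2 * K_mean_above w + A3 \<le> tail_R (c / d * x + (1 - c))"
  unfolding tail_R_fixpoint expectation_of_K_combination(2)[symmetric]
  by (intro integral_mono tail_S_K_integrable expectation_of_K_combination(1) assms)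

context
  fixes p :: real
  assumes p: "1 < p" "p \<le> 2" and Rp: "integrable M (\<lambda>\<omega>. R \<omega> powr p)"
begin

text \<open>
  The event \<open>K > \<eta> * x\<close> is given away completely; for \<open>k \<le> \<eta> * x\<close> the mean \<open>k\<close> of the sum is small
  compared with \<open>x\<close>, so the single jump must be almost as large as \<open>x\<close>.  Keeping the argument
  of \<open>tail_R\<close> close to \<open>x\<close> matters, since it decides whether the recursion contracts.
\<close>

lemma tail_R_upper_crude:
  assumes \<eta>: "0 < \<eta>" "\<eta> < 1 / 2" and \<beta>: "0 < \<beta>"
  shows "\<exists>\<epsilon>>0. \<exists>C>0. \<forall>x\<ge>1. tail_R (c / d * x + (1 - c))
     \<le> tail_K (\<eta> * x) + d * tail_R ((1 - 2 * \<eta>) * x) + d * (x * (tail_R (\<epsilon> * x))\<^sup>2) + C * x powr (- \<beta>)"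
proof -
  obtain \<epsilon> C where \<epsilon>: "\<epsilon> > 0" "C > 0" and J: "\<And>x k s. x \<ge> 1 \<Longrightarrow> real k \<le> x \<Longrightarrow> s \<ge> 0 \<Longrightarrow>
    tail_S k (real k + (s + \<eta>) * x) \<le> real k * tail_R (s * x) + (real k)\<^sup>2 * (tail_R (\<epsilon> * x))\<^sup>2 + C * x powr (- \<beta>)"
    using tail_S_le_jumps[OF p Rp \<eta>(1) \<beta>] by blast
  have "tail_R (c / d * x + (1 - c)) \<le> 1 * tail_K (\<eta> * x) + (tail_R ((1 - 2 * \<eta>) * x) + x * (tail_R (\<epsilon> * x))\<^sup>2) * d + 0 * K_mean_above x + C * x powr (- \<beta>)"
    if x: "x \<ge> 1" for x
  proof (rule tail_R_fixpoint_le)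
    fix k
    have C: "C * x powr (- \<beta>) \<ge> 0" using \<epsilon> by simp
    show "tail_S k x \<le> 1 * indicator {\<eta> * x<..} (real k) + (tail_R ((1 - 2 * \<eta>) * x) + x * (tail_R (\<epsilon> * x))\<^sup>2) * real k
        + 0 * (real k * indicator {x<..} (real k)) + C * x powr (- \<beta>)"
    proof (cases "\<eta> * x < real k")
      case True
      have "0 \<le> (tail_R ((1 - 2 * \<eta>) * x) + x * (tail_R (\<epsilon> * x))\<^sup>2) * real k" using x tail_R_nonneg by simp
      then show ?thesis using True tail_S_le_1[of k x] C by simp
    next
      case False
      have "\<eta> * x \<le> 1 * x" using \<eta> x by (intro mult_right_mono) auto
      then have kx: "real k \<le> x" using False by linarith
      have "real k + (1 - 2 * \<eta> + \<eta>) * x \<le> x" using False by (simp add: algebra_simps)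
      then have "tail_S k x \<le> tail_S k (real k + (1 - 2 * \<eta> + \<eta>) * x)" by (rule tail_S_antimono)
      also have "\<dots> \<le> real k * tail_R ((1 - 2 * \<eta>) * x) + (real k)\<^sup>2 * (tail_R (\<epsilon> * x))\<^sup>2 + C * x powr (- \<beta>)"
        using x kx \<eta> by (intro J) auto
      also have "(real k)\<^sup>2 * (tail_R (\<epsilon> * x))\<^sup>2 \<le> (x * real k) * (tail_R (\<epsilon> * x))\<^sup>2"
        using kx by (intro mult_right_mono) (auto simp: power2_eq_square intro: mult_right_mono)
      finally show ?thesis using False by (simp add: algebra_simps)
    qed
  qed
  then show ?thesis using \<epsilon> by (intro exI[of _ \<epsilon>] conjI exI[of _ C]) (auto simp: algebra_simps)
qed

text \<open>
  Three ranges of \<open>k\<close>.  For \<open>k > x\<close> nothing is lost.  For \<open>k \<le> \<delta> * x\<close> the jump must exceed \<open>x\<close>.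
  In between, a jump of size \<open>2 * \<delta> * x\<close> suffices, but this range carries only the small part
  \<open>K_mean_above (\<delta> * x)\<close> of the mean of \<open>K\<close>.
\<close>

lemma tail_R_upper_sharp:
  assumes \<delta>: "0 < \<delta>" "\<delta> < 1" and \<beta>: "0 < \<beta>"
  shows "\<exists>\<epsilon>>0. \<exists>C>0. \<forall>x\<ge>1. tail_R (c / d * ((1 + 3 * \<delta>) * x) + (1 - c))
     \<le> tail_K x + d * tail_R x + (K_mean_above (\<delta> * x) * tail_R (2 * \<delta> * x) + d * (x * (tail_R (\<epsilon> * x))\<^sup>2) + C * x powr (- \<beta>))"
proof -
  obtain \<epsilon> C where \<epsilon>: "\<epsilon> > 0" "C > 0" and J: "\<And>x k s. x \<ge> 1 \<Longrightarrow> real k \<le> x \<Longrightarrow> s \<ge> 0 \<Longrightarrow>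
    tail_S k (real k + (s + \<delta>) * x) \<le> real k * tail_R (s * x) + (real k)\<^sup>2 * (tail_R (\<epsilon> * x))\<^sup>2 + C * x powr (- \<beta>)"
    using tail_S_le_jumps[OF p Rp \<delta>(1) \<beta>] by blast
  have "tail_R (c / d * ((1 + 3 * \<delta>) * x) + (1 - c))
     \<le> 1 * tail_K x + (tail_R x + x * (tail_R (\<epsilon> * x))\<^sup>2) * d + tail_R (2 * \<delta> * x) * K_mean_above (\<delta> * x) + C * x powr (- \<beta>)"
    if x: "x \<ge> 1" for x
  proof (rule tail_R_fixpoint_le)
    fix k
    have nn: "C * x powr (- \<beta>) \<ge> 0" "0 \<le> tail_R (2 * \<delta> * x) * (real k * indicator {\<delta> * x<..} (real k))"
      "0 \<le> tail_R x * real k" "0 \<le> x * (tail_R (\<epsilon> * x))\<^sup>2 * real k"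
      using \<epsilon> x tail_R_nonneg by auto
    have sq: "(real k)\<^sup>2 * (tail_R (\<epsilon> * x))\<^sup>2 \<le> x * (tail_R (\<epsilon> * x))\<^sup>2 * real k" if "real k \<le> x"
    proof -
      have "(real k)\<^sup>2 * (tail_R (\<epsilon> * x))\<^sup>2 \<le> (x * real k) * (tail_R (\<epsilon> * x))\<^sup>2"
        using that by (intro mult_right_mono) (auto simp: power2_eq_square intro: mult_right_mono)
      then show ?thesis by (simp add: mult_ac)
    qed
    show "tail_S k ((1 + 3 * \<delta>) * x) \<le> 1 * indicator {x<..} (real k) + (tail_R x + x * (tail_R (\<epsilon> * x))\<^sup>2) * real k
        + tail_R (2 * \<delta> * x) * (real k * indicator {\<delta> * x<..} (real k)) + C * x powr (- \<beta>)"
    proof -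
      consider "x < real k" | "\<delta> * x < real k" "real k \<le> x" | "real k \<le> \<delta> * x" by linarith
      then show ?thesis
      proof cases
        case 1
        then show ?thesis using tail_S_le_1[of k "(1 + 3 * \<delta>) * x"] nn by (simp add: distrib_right)
      next
        case 2
        have "tail_S k ((1 + 3 * \<delta>) * x) \<le> tail_S k (real k + (2 * \<delta> + \<delta>) * x)"
          using 2 by (intro tail_S_antimono) (simp add: algebra_simps)
        also have "\<dots> \<le> real k * tail_R (2 * \<delta> * x) + (real k)\<^sup>2 * (tail_R (\<epsilon> * x))\<^sup>2 + C * x powr (- \<beta>)"
          using x 2 \<delta> by (intro J) auto
        finally show ?thesis using 2 sq[OF 2(2)] nn by (simp add: algebra_simps)
      next
        case 3
        have "\<delta> * x \<le> 1 * x" using \<delta> x by (intro mult_right_mono) auto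
        then have kx: "real k \<le> x" using 3 by linarith
        have "tail_S k ((1 + 3 * \<delta>) * x) \<le> tail_S k (real k + ((1 + \<delta>) + \<delta>) * x)"
          using 3 by (intro tail_S_antimono) (simp add: algebra_simps)
        also have "\<dots> \<le> real k * tail_R ((1 + \<delta>) * x) + (real k)\<^sup>2 * (tail_R (\<epsilon> * x))\<^sup>2 + C * x powr (- \<beta>)"
          using x kx \<delta> by (intro J) auto
        also have "real k * tail_R ((1 + \<delta>) * x) \<le> real k * tail_R x"
          using \<delta> x by (intro mult_left_mono tail_R_antimono) (auto simp: algebra_simps)
        finally show ?thesis using kx sq[OF kx] nn by (simp add: algebra_simps)
      qed
    qed
  qed
  then show ?thesis using \<epsilon> by (intro exI[of _ \<epsilon>] conjI exI[of _ C]) (auto simp: algebra_simps)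
qed

lemma tail_R_tendsto_0: "(tail_R \<longlongrightarrow> 0) at_top"
proof (rule tendsto_sandwich[where f="\<lambda>_. 0"])
  show "\<forall>\<^sub>F y in at_top. tail_R y \<le> expectation (\<lambda>\<omega>. R \<omega> powr p) * y powr (- p)"
    using eventually_gt_at_top[of 0] by eventually_elim (rule tail_R_le_moment[OF p Rp])
  show "((\<lambda>y. expectation (\<lambda>\<omega>. R \<omega> powr p) * y powr (- p)) \<longlongrightarrow> 0) at_top"
    using p by (intro tendsto_mult_right_zero tendsto_neg_powr filterlim_ident) auto
qed (auto simp: tail_R_nonneg)

lemma x_tail_R_tendsto_0:
  assumes "0 < \<epsilon>"
  shows "((\<lambda>x. x * tail_R (\<epsilon> * x)) \<longlongrightarrow> 0) at_top"
proof (rule tendsto_sandwich[where f="\<lambda>_. 0"])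
  define m where "m = expectation (\<lambda>\<omega>. R \<omega> powr p)"
  show "\<forall>\<^sub>F x in at_top. x * tail_R (\<epsilon> * x) \<le> m * \<epsilon> powr (- p) * x powr (- (p - 1))"
    using eventually_gt_at_top[of 0]
  proof eventually_elim
    case (elim x)
    have "x * tail_R (\<epsilon> * x) \<le> x * (m * (\<epsilon> * x) powr (- p))"
      unfolding m_def using elim assms by (intro mult_left_mono tail_R_le_moment[OF p Rp]) auto
    also have "\<dots> = m * \<epsilon> powr (- p) * (x powr 1 * x powr (- p))"
      using elim assms by (simp add: powr_mult)
    also have "x powr 1 * x powr (- p) = x powr (- (p - 1))"
      unfolding powr_add[symmetric] by simp
    finally show ?case .
  qed
  show "((\<lambda>x. m * \<epsilon> powr (- p) * x powr (- (p - 1))) \<longlongrightarrow> 0) at_top"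
    using p by (intro tendsto_mult_right_zero tendsto_neg_powr filterlim_ident) auto
  show "\<forall>\<^sub>F x in at_top. 0 \<le> x * tail_R (\<epsilon> * x)"
    using eventually_ge_at_top[of 0] by eventually_elim (simp add: tail_R_nonneg)
qed auto

text \<open>
  For \<open>k > x\<close> the law of large numbers makes the sum exceed \<open>(1 - \<delta>) * x\<close>; for \<open>k\<close> below a
  fixed \<open>m\<close> one jump above \<open>x\<close> suffices, and \<open>m\<close> is chosen so large that these \<open>k\<close> carry
  almost the whole mean \<open>d\<close>.
\<close>

lemma tail_R_lower:
  assumes \<delta>: "0 < \<delta>" "\<delta> < 1 / 2"
  shows "\<forall>\<^sub>F x in at_top. (1 - \<delta>) * tail_K x + (d - 2 * \<delta>) * tail_R x \<le> tail_R (c / d * (1 - \<delta>) * x)"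
proof -
  obtain \<kappa> where \<kappa>: "\<kappa> > 0" and low: "\<And>k. 1 - exp (- \<kappa> * real k) \<le> tail_S k ((1 - \<delta>) * real k)"
    using sum_lower_tail[OF p Rp \<delta>(1)] by blast
  have "\<forall>\<^sub>F w in at_top. K_mean_above w < \<delta>" using order_tendstoD(2)[OF K_mean_above_tendsto_0 \<delta>(1)] .
  then obtain m where m: "m \<ge> 0" "K_mean_above m < \<delta>"
    by (metis eventually_at_top_linorder max.cobounded1 max.cobounded2)
  have "((\<lambda>x. m\<^sup>2 * tail_R x) \<longlongrightarrow> 0) at_top" by (intro tendsto_mult_right_zero tail_R_tendsto_0)
  then have ev1: "\<forall>\<^sub>F x in at_top. m\<^sup>2 * tail_R x < \<delta>" using \<delta> by (intro order_tendstoD)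
  have "((\<lambda>x. exp (- \<kappa> * x)) \<longlongrightarrow> 0) at_top" using \<kappa> by real_asymp
  then have ev2: "\<forall>\<^sub>F x in at_top. exp (- \<kappa> * x) < \<delta>" using \<delta> by (intro order_tendstoD)
  show ?thesis using ev1 ev2 eventually_ge_at_top[of m] eventually_ge_at_top[of 0]
  proof eventually_elim
    case (elim x)
    have "(1 - \<delta>) * tail_K x + tail_R x * d + (- tail_R x) * K_mean_above m + - (m\<^sup>2 * (tail_R x)\<^sup>2) \<le> tail_R (c / d * ((1 - \<delta>) * x) + (1 - c))"
    proof (rule tail_R_fixpoint_ge)
      fix k
      have nn: "0 \<le> m\<^sup>2 * (tail_R x)\<^sup>2" by simp
      show "(1 - \<delta>) * indicator {x<..} (real k) + tail_R x * real k + (- tail_R x) * (real k * indicator {m<..} (real k))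
          + - (m\<^sup>2 * (tail_R x)\<^sup>2) \<le> tail_S k ((1 - \<delta>) * x)"
      proof -
        consider "x < real k" | "m < real k" "real k \<le> x" | "real k \<le> m" by linarith
        then show ?thesis
        proof cases
          case 1
          have "exp (- \<kappa> * real k) \<le> exp (- \<kappa> * x)" using 1 \<kappa> by simp
          then have "1 - \<delta> \<le> tail_S k ((1 - \<delta>) * real k)" using low[of k] elim by linarith
          also have "\<dots> \<le> tail_S k ((1 - \<delta>) * x)" using 1 \<delta> by (intro tail_S_antimono mult_left_mono) auto
          finally have "1 - \<delta> - m\<^sup>2 * (tail_R x)\<^sup>2 \<le> tail_S k ((1 - \<delta>) * x)" using nn by linarith
          then show ?thesis using 1 elim by simp
        next
          case 2
          have "- (m\<^sup>2 * (tail_R x)\<^sup>2) \<le> tail_S k ((1 - \<delta>) * x)"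
            using nn tail_S_nonneg[of k "(1 - \<delta>) * x"] by linarith
          then show ?thesis using 2 by simp
        next
          case 3
          have "(real k)\<^sup>2 * (tail_R x)\<^sup>2 \<le> m\<^sup>2 * (tail_R x)\<^sup>2" using 3 by (intro mult_right_mono power_mono) auto
          moreover have "real k * tail_R x - (real k)\<^sup>2 * (tail_R x)\<^sup>2 \<le> tail_S k x" by (rule tail_S_ge_single_jump)
          moreover have "tail_S k x \<le> tail_S k ((1 - \<delta>) * x)"
            using \<delta> elim by (intro tail_S_antimono) (simp add: algebra_simps)
          ultimately show ?thesis using 3 elim by (simp add: mult.commute)
        qed
      qed
    qed
    also have "\<dots> \<le> tail_R (c / d * (1 - \<delta>) * x)" using c by (intro tail_R_antimono) (simp add: mult.assoc)
    finally have 1: "(1 - \<delta>) * tail_K x + tail_R x * d + (- tail_R x) * K_mean_above m + - (m\<^sup>2 * (tail_R x)\<^sup>2) \<le> tail_R (c / d * (1 - \<delta>) * x)" .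
    have "tail_R x * K_mean_above m \<le> tail_R x * \<delta>" using m tail_R_nonneg by (intro mult_left_mono) auto
    moreover have "m\<^sup>2 * tail_R x * tail_R x \<le> \<delta> * tail_R x" using elim tail_R_nonneg by (intro mult_right_mono) auto
    ultimately show ?case using 1 by (simp add: algebra_simps power2_eq_square)
  qed
qed

text \<open>
  All error terms of the sharp bound are negligible compared with a regularly varying \<open>W\<close> that dominates the
  tail of \<open>R\<close>.  It is applied to \<open>W = tail_R\<close> in one direction of the equivalence and to
  \<open>W = tail_K\<close> in the other.  The shift \<open>1 - c\<close> is absorbed by a fourth \<open>\<delta>\<close> in the scale.
\<close>

lemma tail_R_upper:
  assumes \<delta>: "0 < \<delta>" "\<delta> < 1" and W: "regular_tail \<alpha> W" and \<alpha>: "1 < \<alpha>"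
    and D: "0 < D" and dom: "\<forall>\<^sub>F x in at_top. tail_R x \<le> D * W x"
  shows "\<forall>\<^sub>F x in at_top. tail_R (c / d * (1 + 4 * \<delta>) * x) \<le> tail_K x + d * tail_R x + \<delta> * W x"
proof -
  have cd: "c / d > 0" using c d by simp
  define \<beta> where "\<beta> = \<alpha> + 2"
  obtain \<epsilon> C where \<epsilon>: "\<epsilon> > 0" "C > 0" and up: "\<And>x. x \<ge> 1 \<Longrightarrow> tail_R (c / d * ((1 + 3 * \<delta>) * x) + (1 - c))
     \<le> tail_K x + d * tail_R x + (K_mean_above (\<delta> * x) * tail_R (2 * \<delta> * x) + d * (x * (tail_R (\<epsilon> * x))\<^sup>2) + C * x powr (- \<beta>))"
    using tail_R_upper_sharp[OF \<delta>, of \<beta>] \<alpha> by (auto simp: \<beta>_def)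
  have scaled: "\<exists>E>0. \<forall>\<^sub>F x in at_top. tail_R (t * x) \<le> E * W x" if t: "0 < t" for t
  proof -
    have "\<forall>\<^sub>F x in at_top. tail_R (t * x) \<le> D * W (t * x)" using dom by (rule eventually_scale_at_top[OF t])
    moreover have "\<forall>\<^sub>F x in at_top. W (t * x) \<le> (t powr (- \<alpha>) + 1) * W x"
      by (rule regular_tail_scale_less[OF W t]) simp
    ultimately have "\<forall>\<^sub>F x in at_top. tail_R (t * x) \<le> D * (t powr (- \<alpha>) + 1) * W x"
    proof eventually_elim
      case (elim x)
      have "D * W (t * x) \<le> D * ((t powr (- \<alpha>) + 1) * W x)" using elim D by (intro mult_left_mono) auto
      then show ?case using elim by (simp add: mult.assoc)
    qed
    moreover have "D * (t powr (- \<alpha>) + 1) > 0" using D t by (auto intro!: mult_pos_pos add_pos_pos)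
    ultimately show ?thesis by blast
  qed
  obtain E1 where E1: "E1 > 0" "\<forall>\<^sub>F x in at_top. tail_R (2 * \<delta> * x) \<le> E1 * W x" using scaled[of "2 * \<delta>"] \<delta> by auto
  obtain E2 where E2: "E2 > 0" "\<forall>\<^sub>F x in at_top. tail_R (\<epsilon> * x) \<le> E2 * W x" using scaled[of \<epsilon>] \<epsilon> by auto
  obtain C0 where C0: "C0 > 0" "\<forall>\<^sub>F x in at_top. C0 * x powr (- (\<alpha> + 1)) \<le> W x"
    using regular_tail_ge_power[OF W, of "\<alpha> + 1"] \<alpha> by auto
  have e1: "\<forall>\<^sub>F x in at_top. K_mean_above (\<delta> * x) < \<delta> / (3 * E1)"
    using \<delta> E1 by (intro eventually_scale_at_top order_tendstoD[OF K_mean_above_tendsto_0]) auto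
  have e2: "\<forall>\<^sub>F x in at_top. x * tail_R (\<epsilon> * x) < \<delta> / (3 * d * E2)"
    using \<delta> E2 d by (intro order_tendstoD[OF x_tail_R_tendsto_0[OF \<epsilon>(1)]]) auto
  have e3: "\<forall>\<^sub>F x in at_top. x powr (- 1) < \<delta> * C0 / (3 * C)"
    using \<delta> C0 \<epsilon> by (intro order_tendstoD(2)[OF tendsto_neg_powr[OF _ filterlim_ident]]) auto
  show ?thesis
    using E1(2) E2(2) C0(2) e1 e2 e3 eventually_ge_at_top[of 1] eventually_ge_at_top[of "(1 - c) / (c / d * \<delta>)"]
  proof eventually_elim
    case (elim x)
    have Wx: "W x > 0" using regular_tailD(2)[OF W] .
    have t1: "K_mean_above (\<delta> * x) * tail_R (2 * \<delta> * x) \<le> \<delta> / (3 * E1) * (E1 * W x)"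
      using elim K_mean_above_nonneg tail_R_nonneg \<delta> E1 by (intro mult_mono) auto
    have "x * tail_R (\<epsilon> * x) * tail_R (\<epsilon> * x) \<le> \<delta> / (3 * d * E2) * (E2 * W x)"
      using elim tail_R_nonneg \<delta> E2 d by (intro mult_mono) auto
    then have "d * (x * tail_R (\<epsilon> * x) * tail_R (\<epsilon> * x)) \<le> d * (\<delta> / (3 * d * E2) * (E2 * W x))"
      using d by (intro mult_left_mono) auto
    then have t2: "d * (x * (tail_R (\<epsilon> * x))\<^sup>2) \<le> \<delta> / 3 * W x"
      using d E2 by (simp add: power2_eq_square mult.assoc)
    have "x powr (- \<beta>) = x powr (- 1) * x powr (- (\<alpha> + 1))"
      unfolding \<beta>_def powr_add[symmetric] by (intro arg_cong2[where f="(powr)"]) auto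
    also have "\<dots> \<le> \<delta> * C0 / (3 * C) * (W x / C0)"
      using elim C0 \<delta> \<epsilon> Wx by (intro mult_mono) (auto simp: field_simps)
    finally have "C * x powr (- \<beta>) \<le> C * (\<delta> * C0 / (3 * C) * (W x / C0))"
      using \<epsilon> by (intro mult_left_mono) auto
    then have t3: "C * x powr (- \<beta>) \<le> \<delta> / 3 * W x" using \<epsilon> C0 by simp
    have "1 - c \<le> x * (c / d * \<delta>)" using elim cd \<delta> by (simp only: pos_divide_le_eq mult_pos_pos)
    moreover have "a * (1 + 4 * \<delta>) * x = a * ((1 + 3 * \<delta>) * x) + x * (a * \<delta>)" for a
      by algebra
    from this[of "c / d"] have "c / d * (1 + 4 * \<delta>) * x = c / d * ((1 + 3 * \<delta>) * x) + x * (c / d * \<delta>)" .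
    ultimately have "c / d * ((1 + 3 * \<delta>) * x) + (1 - c) \<le> c / d * (1 + 4 * \<delta>) * x"
      by linarith
    then have "tail_R (c / d * (1 + 4 * \<delta>) * x) \<le> tail_R (c / d * ((1 + 3 * \<delta>) * x) + (1 - c))" by (rule tail_R_antimono)
    also have "\<dots> \<le> tail_K x + d * tail_R x + (K_mean_above (\<delta> * x) * tail_R (2 * \<delta> * x) + d * (x * (tail_R (\<epsilon> * x))\<^sup>2) + C * x powr (- \<beta>))"
      using elim by (intro up)
    also have "\<dots> \<le> tail_K x + d * tail_R x + \<delta> * W x" using t1 t2 t3 E1 by simp
    finally show ?case .
  qed
qed

end

end

section \<open>Limits of the tail ratio\<close>

context random_sum_fixpoint
begin

lemma cd: "0 < c / d" "c / d < 1" "c / d * d = c"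
  using c d by auto

lemma R_moment_of_regular_tail_R:
  assumes "regular_tail \<alpha> tail_R" "1 < \<alpha>"
  obtains p where "1 < p" "p \<le> 2" "integrable M (\<lambda>\<omega>. R \<omega> powr p)"
proof -
  define r where "r = (1 + min \<alpha> 2) / 2"
  have r: "1 < r" "r < \<alpha>" "r \<le> 2" using assms by (auto simp: r_def)
  obtain C where "\<forall>\<^sub>F x in at_top. tail_R x \<le> C * x powr (- r)"
    using regular_tail_le_power[OF assms(1) r(2)] r by auto
  then have "integrable M (\<lambda>\<omega>. R \<omega> powr ((1 + r) / 2))"
    using r R_nonneg by (intro integrable_powr_of_tail[where r=r and C=C]) (auto simp: tail_R_def)
  then show ?thesis using that[of "(1 + r) / 2"] r by auto
qed

lemma R_moment_of_regular_tail_K: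
  assumes "regular_tail \<alpha> tail_K" "1 < \<alpha>"
  obtains p where "1 < p" "p \<le> 2" "integrable M (\<lambda>\<omega>. R \<omega> powr p)"
proof -
  define r where "r = (1 + min \<alpha> 2) / 2"
  have r: "1 < r" "r < \<alpha>" "r \<le> 2" using assms by (auto simp: r_def)
  obtain C where "\<forall>\<^sub>F x in at_top. tail_K x \<le> C * x powr (- r)"
    using regular_tail_le_power[OF assms(1) r(2)] r by auto
  then have "integrable M (\<lambda>\<omega>. real (K \<omega>) powr ((1 + r) / 2))"
    using r by (intro integrable_powr_of_tail[where r=r and C=C]) (auto simp: tail_K_def)
  then have "integrable M (\<lambda>\<omega>. R \<omega> powr ((1 + r) / 2))"
    using r by (intro R_moment_of_K_moment) auto
  then show ?thesis using that[of "(1 + r) / 2"] r by auto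
qed

text \<open>
  The bounds \<open>tail_R_upper\<close> and \<open>tail_R_lower\<close> are divided by \<open>tail_R x\<close>; for small \<open>\<delta>\<close> the limits of
  the resulting bounds are as close to the claim as desired.
\<close>

lemma ratio_of_regular_tail_R:
  assumes tail_R: "regular_tail \<alpha> tail_R" and \<alpha>: "1 < \<alpha>"
  shows "((\<lambda>x. tail_K x / tail_R x) \<longlongrightarrow> (c / d) powr (- \<alpha>) - d) at_top"
proof -
  obtain p where p: "1 < p" "p \<le> 2" "integrable M (\<lambda>\<omega>. R \<omega> powr p)"
    using R_moment_of_regular_tail_R[OF assms] .
  have qpos: "tail_R x > 0" for x using regular_tailD(2)[OF tail_R] .
  define a where "a = c / d"
  have a: "a > 0" using cd by (simp add: a_def)
  show ?thesis
  proof (rule order_tendstoI)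
    fix l assume "l < (c / d) powr (- \<alpha>) - d"
    moreover have "((\<lambda>\<delta>. (a * (1 + 4 * \<delta>)) powr (- \<alpha>) - d - 2 * \<delta>) \<longlongrightarrow> (a * (1 + 4 * 0)) powr (- \<alpha>) - d - 2 * 0) (at_right 0)"
      using a by (intro tendsto_intros) auto
    ultimately have "\<forall>\<^sub>F \<delta> in at_right 0. l < (a * (1 + 4 * \<delta>)) powr (- \<alpha>) - d - 2 * \<delta>"
      by (intro order_tendstoD(1)) (auto simp: a_def)
    moreover have "\<forall>\<^sub>F \<delta>::real in at_right 0. \<delta> \<in> {0<..<1}" by (rule eventually_at_right_real) simp
    ultimately have "\<forall>\<^sub>F \<delta> in at_right 0. l < (a * (1 + 4 * \<delta>)) powr (- \<alpha>) - d - 2 * \<delta> \<and> \<delta> \<in> {0<..<1}"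
      by (rule eventually_conj)
    then obtain \<delta> where \<delta>: "0 < \<delta>" "\<delta> < 1" "l + 2 * \<delta> + d < (a * (1 + 4 * \<delta>)) powr (- \<alpha>)"
      by (auto dest!: eventually_happens)
    have "\<forall>\<^sub>F x in at_top. tail_R (a * (1 + 4 * \<delta>) * x) \<le> tail_K x + d * tail_R x + \<delta> * tail_R x"
      unfolding a_def by (rule tail_R_upper[OF p \<delta>(1,2) tail_R \<alpha>, of 1]) auto
    moreover have "\<forall>\<^sub>F x in at_top. (l + 2 * \<delta> + d) * tail_R x \<le> tail_R (a * (1 + 4 * \<delta>) * x)"
      using \<delta> a by (intro regular_tail_scale_greater[OF tail_R]) auto
    ultimately show "\<forall>\<^sub>F x in at_top. l < tail_K x / tail_R x"
    proof eventually_elim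
      case (elim x)
      then have "(l + \<delta>) * tail_R x \<le> tail_K x" by (simp add: algebra_simps)
      moreover have "l * tail_R x < (l + \<delta>) * tail_R x" using qpos[of x] \<delta> by (intro mult_strict_right_mono) auto
      ultimately have "l * tail_R x < tail_K x" by linarith
      then show ?case using qpos[of x] by (simp add: pos_less_divide_eq)
    qed
  next
    fix u assume "(c / d) powr (- \<alpha>) - d < u"
    moreover have "((\<lambda>\<delta>. ((a * (1 - \<delta>)) powr (- \<alpha>) - d + 3 * \<delta>) / (1 - \<delta>)) \<longlongrightarrow> ((a * (1 - 0)) powr (- \<alpha>) - d + 3 * 0) / (1 - 0)) (at_right 0)"
      using a by (intro tendsto_intros) auto
    ultimately have "\<forall>\<^sub>F \<delta> in at_right 0. ((a * (1 - \<delta>)) powr (- \<alpha>) - d + 3 * \<delta>) / (1 - \<delta>) < u"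
      by (intro order_tendstoD(2)) (auto simp: a_def)
    moreover have "\<forall>\<^sub>F \<delta>::real in at_right 0. \<delta> \<in> {0<..<1/2}" by (rule eventually_at_right_real) simp
    ultimately have "\<forall>\<^sub>F \<delta> in at_right 0. ((a * (1 - \<delta>)) powr (- \<alpha>) - d + 3 * \<delta>) / (1 - \<delta>) < u \<and> \<delta> \<in> {0<..<1/2}"
      by (rule eventually_conj)
    then obtain \<delta> where \<delta>: "0 < \<delta>" "\<delta> < 1 / 2" "((a * (1 - \<delta>)) powr (- \<alpha>) - d + 3 * \<delta>) / (1 - \<delta>) < u"
      by (auto dest!: eventually_happens)
    define m where "m = (a * (1 - \<delta>)) powr (- \<alpha>) + \<delta>"
    have "\<forall>\<^sub>F x in at_top. (1 - \<delta>) * tail_K x + (d - 2 * \<delta>) * tail_R x \<le> tail_R (a * (1 - \<delta>) * x)"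
      unfolding a_def by (rule tail_R_lower[OF p \<delta>(1,2)])
    moreover have "\<forall>\<^sub>F x in at_top. tail_R (a * (1 - \<delta>) * x) \<le> m * tail_R x"
      using \<delta> a by (intro regular_tail_scale_less[OF tail_R]) (auto simp: m_def)
    ultimately show "\<forall>\<^sub>F x in at_top. tail_K x / tail_R x < u"
    proof eventually_elim
      case (elim x)
      have "m - d + 2 * \<delta> < u * (1 - \<delta>)" using \<delta> by (simp add: m_def pos_divide_less_eq)
      then have "(m - d + 2 * \<delta>) * tail_R x < u * (1 - \<delta>) * tail_R x" using qpos[of x] by (intro mult_strict_right_mono)
      moreover have "(1 - \<delta>) * tail_K x \<le> (m - d + 2 * \<delta>) * tail_R x" using elim by (simp add: algebra_simps)
      ultimately have "(1 - \<delta>) * tail_K x < (1 - \<delta>) * (u * tail_R x)" by (simp add: mult_ac)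
      then show ?case using qpos[of x] \<delta> by (simp add: pos_divide_less_eq)
    qed
  qed
qed

text \<open>
  Here \<open>tail_domination\<close> is applied with \<open>r\<close> slightly larger than \<open>a = c / d\<close>; as \<open>d * a = c < 1\<close>, there
  is room for \<open>d * r < 1\<close>.  The two-jump term fits because \<open>x * tail_R (\<epsilon> * x) \<rightarrow> 0\<close>.
\<close>

lemma tail_R_dominated_by_tail_K:
  assumes tail_K: "regular_tail \<alpha> tail_K" and \<alpha>: "1 < \<alpha>"
    and p: "1 < p" "p \<le> 2" "integrable M (\<lambda>\<omega>. R \<omega> powr p)"
  shows "\<exists>D>0. \<forall>\<^sub>F y in at_top. tail_R y \<le> D * tail_K y"
proof -
  define a where "a = c / d"
  \<comment> \<open>a positive number with \<open>c < 1 - 4 * \<eta>\<close>, so that \<open>d * r < 1\<close> below\<close>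
  define \<eta> where "\<eta> = (1 - c) / 8"
  define r where "r = a / (1 - 4 * \<eta>)"
  have a: "0 < a" "a \<le> c" using c d by (auto simp: a_def divide_le_eq mult_le_cancel_left1)
  have \<eta>: "0 < \<eta>" "\<eta> < 1 / 2" using c by (auto simp: \<eta>_def)
  have c\<eta>: "c < 1 - 4 * \<eta>" using c by (simp add: \<eta>_def field_simps)
  have r: "0 < r" "r < 1" using a c\<eta> c by (auto simp: r_def)
  have "d * r = c / (1 - 4 * \<eta>)" using d by (simp add: r_def a_def)
  then have dr: "d * r < 1" using c\<eta> c by simp
  define \<beta> where "\<beta> = \<alpha> + 1"
  obtain \<epsilon> C where \<epsilon>: "\<epsilon> > 0" "C > 0" and up: "\<And>x. x \<ge> 1 \<Longrightarrow> tail_R (a * x + (1 - c))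
     \<le> tail_K (\<eta> * x) + d * tail_R ((1 - 2 * \<eta>) * x) + d * (x * (tail_R (\<epsilon> * x))\<^sup>2) + C * x powr (- \<beta>)"
    using tail_R_upper_crude[OF p \<eta>(1,2), of \<beta>] \<alpha> by (auto simp: \<beta>_def a_def)
  define e where "e = (1 - \<eta>) / a"
  have e: "e > 0" using \<eta> a by (simp add: e_def)
  obtain C0 where C0: "C0 > 0" "\<forall>\<^sub>F x in at_top. C0 * x powr (- \<beta>) \<le> tail_K x"
    using regular_tail_ge_power[OF tail_K, of \<beta>] \<alpha> by (auto simp: \<beta>_def)
  define B where "B = (\<eta> * e) powr (- \<alpha>) + 1"
  have evB: "\<forall>\<^sub>F y in at_top. tail_K (\<eta> * e * y) \<le> B * tail_K y"
    using \<eta> e by (intro regular_tail_scale_less[OF tail_K]) (auto simp: B_def)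
  define C1 where "C1 = B + C * e powr (- \<beta>) / C0"
  show ?thesis
  proof (rule tail_domination[OF tail_K \<alpha>, where r=r and d=d and e="\<epsilon> * e" and C=C1])
    show "y * tail_R y \<le> 1" if "0 < y" for y
    proof -
      have "tail_R y \<le> prob {\<omega>\<in>space M. y \<le> R \<omega>}"
        unfolding tail_R_def by (intro finite_measure_mono) auto
      also have "\<dots> \<le> expectation R / y"
        using that R_nonneg by (intro integral_Markov_inequality_measure[where A="{}"] R_integrable) auto
      finally show ?thesis using that by (simp add: R_mean field_simps)
    qed
    show "0 \<le> C1" using C0 \<epsilon> by (simp add: C1_def B_def)
    show "0 < \<epsilon> * e" using \<epsilon> e by simp
    fix \<theta> :: real assume \<theta>: "\<theta> > 0"
    \<comment> \<open>evaluate the bound at \<open>x = (y - (1 - c)) / a\<close>, which is at least \<open>e * y\<close> for large \<open>y\<close>\<close>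
    define x where "x y = (y - (1 - c)) / a" for y
    have x_top: "filterlim x at_top at_top"
      unfolding x_def using a by real_asymp
    have "\<forall>\<^sub>F x in at_top. x * tail_R (\<epsilon> * x) < \<theta> / d"
      using \<theta> d by (intro order_tendstoD(2)[OF x_tail_R_tendsto_0[OF p \<epsilon>(1)]]) auto
    then have ev\<theta>: "\<forall>\<^sub>F y in at_top. x y * tail_R (\<epsilon> * x y) < \<theta> / d"
      using x_top by (rule eventually_compose_filterlim)
    have ev1: "\<forall>\<^sub>F y in at_top. 1 \<le> x y"
      using eventually_compose_filterlim[OF eventually_ge_at_top x_top] .
    show "\<forall>\<^sub>F y in at_top. tail_R y \<le> C1 * tail_K y + d * tail_R (y / r) + \<theta> * tail_R (\<epsilon> * e * y)"
      using ev\<theta> ev1 evB C0(2) eventually_ge_at_top[of "(1 - c) / \<eta>"] eventually_gt_at_top[of 0]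
    proof eventually_elim
      case (elim y)
      have y: "a * x y + (1 - c) = y" using a by (simp add: x_def)
      have "1 - c \<le> \<eta> * y" using elim \<eta> by (simp add: pos_divide_le_eq mult.commute)
      then have "(1 - \<eta>) * y / a \<le> (y - (1 - c)) / a"
        using a by (intro divide_right_mono) (auto simp: algebra_simps)
      then have xy: "e * y \<le> x y" by (simp add: x_def e_def)
      have yr: "y / r \<le> (1 - 2 * \<eta>) * x y"
      proof -
        have "(1 - 4 * \<eta>) * y \<le> (1 - 2 * \<eta>) * (1 - \<eta>) * y"
          using elim \<eta> by (intro mult_right_mono) (auto simp: algebra_simps intro: add_nonneg_nonneg)
        then have "(1 - 4 * \<eta>) * y / a \<le> (1 - 2 * \<eta>) * (1 - \<eta>) * y / a"
          using a by (intro divide_right_mono) auto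
        then have "y / r \<le> (1 - 2 * \<eta>) * (e * y)" by (simp add: r_def e_def mult_ac)
        also have "\<dots> \<le> (1 - 2 * \<eta>) * x y" using xy \<eta> by (intro mult_left_mono) auto
        finally show ?thesis .
      qed
      have "tail_R y \<le> tail_K (\<eta> * x y) + d * tail_R ((1 - 2 * \<eta>) * x y) + d * (x y * (tail_R (\<epsilon> * x y))\<^sup>2) + C * x y powr (- \<beta>)"
        using up[of "x y"] elim y by simp
      moreover have "tail_K (\<eta> * x y) \<le> B * tail_K y"
      proof -
        have "tail_K (\<eta> * x y) \<le> tail_K (\<eta> * e * y)" using xy \<eta> by (intro tail_K_antimono) (simp add: mult.assoc)
        then show ?thesis using elim by linarith
      qed
      moreover have "d * tail_R ((1 - 2 * \<eta>) * x y) \<le> d * tail_R (y / r)" using yr d by (intro mult_left_mono tail_R_antimono) auto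
      moreover have "d * (x y * (tail_R (\<epsilon> * x y))\<^sup>2) \<le> \<theta> * tail_R (\<epsilon> * e * y)"
      proof -
        have "tail_R (\<epsilon> * x y) \<le> tail_R (\<epsilon> * e * y)" using xy \<epsilon> by (intro tail_R_antimono) (simp add: mult.assoc)
        then have "x y * tail_R (\<epsilon> * x y) * tail_R (\<epsilon> * x y) \<le> \<theta> / d * tail_R (\<epsilon> * e * y)"
          using elim tail_R_nonneg \<theta> d by (intro mult_mono) auto
        then show ?thesis using d by (simp add: power2_eq_square field_simps)
      qed
      moreover have "C * x y powr (- \<beta>) \<le> C * e powr (- \<beta>) / C0 * tail_K y"
      proof -
        have "x y powr (- \<beta>) \<le> (e * y) powr (- \<beta>)" using xy e elim \<alpha> by (intro powr_mono2') (auto simp: \<beta>_def)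
        also have "\<dots> = e powr (- \<beta>) * y powr (- \<beta>)" using e elim by (simp add: powr_mult)
        also have "\<dots> \<le> e powr (- \<beta>) * (tail_K y / C0)"
          using elim C0 by (intro mult_left_mono) (auto simp: field_simps)
        finally have "C * x y powr (- \<beta>) \<le> C * (e powr (- \<beta>) * (tail_K y / C0))" using \<epsilon> by (intro mult_left_mono) auto
        then show ?thesis by (simp add: field_simps)
      qed
      ultimately show ?case by (simp add: C1_def distrib_right)
    qed
  qed (use r dr d tail_R_nonneg tail_R_le_1 in auto)
qed

text \<open>
  An asymptotic bound \<open>u\<close> for the quotient at \<open>x\<close> is turned by the two-sided bounds into the bound
  \<open>(1 + d * u) * V x / V (a * x) \<approx> a powr \<alpha> * (1 + d * u)\<close> at \<open>a * x\<close>, where \<open>V\<close> is the tail of \<open>K\<close>.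
\<close>

lemma ratio_of_regular_tail_K:
  assumes tail_K: "regular_tail \<alpha> tail_K" and \<alpha>: "1 < \<alpha>"
  shows "((\<lambda>x. tail_R x / tail_K x) \<longlongrightarrow> (c / d) powr \<alpha> / (1 - d * (c / d) powr \<alpha>)) at_top"
proof -
  obtain p where p: "1 < p" "p \<le> 2" "integrable M (\<lambda>\<omega>. R \<omega> powr p)"
    using R_moment_of_regular_tail_K[OF assms] .
  have Vpos: "tail_K x > 0" for x using regular_tailD(2)[OF tail_K] .
  obtain D where D: "D > 0" "\<forall>\<^sub>F y in at_top. tail_R y \<le> D * tail_K y" using tail_R_dominated_by_tail_K[OF tail_K \<alpha> p] by blast
  define a where "a = c / d"
  have a: "0 < a" "a < 1" "d * a = c" using cd by (auto simp: a_def mult.commute)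
  have "a powr \<alpha> < a powr 1" using a \<alpha> by (intro powr_less_mono') auto
  then have "d * a powr \<alpha> < d * a" using a d by (intro mult_strict_left_mono) auto
  then have s1: "d * a powr \<alpha> < 1" using a c by simp
  have "((\<lambda>x. tail_R x / tail_K x) \<longlongrightarrow> a powr \<alpha> / (1 - d * a powr \<alpha>)) at_top"
  proof (rule affine_recursion_limit)
    show "\<forall>\<^sub>F x in at_top. tail_R x / tail_K x \<le> D"
      using D(2) by eventually_elim (use Vpos in \<open>simp add: pos_divide_le_eq\<close>)
  next
    fix u v assume u: "\<forall>\<^sub>F x in at_top. tail_R x / tail_K x \<le> u" and uv: "a powr \<alpha> + d * a powr \<alpha> * u < v"
    obtain x0 where "tail_R x0 / tail_K x0 \<le> u" using u by (auto simp: eventually_at_top_linorder)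
    moreover have "0 \<le> tail_R x0 / tail_K x0" using tail_R_nonneg Vpos[of x0] by simp
    ultimately have u0: "u \<ge> 0" by linarith
    have "0 \<le> a powr \<alpha> + d * a powr \<alpha> * u" using u0 d by simp
    then have v0: "v > 0" using uv by linarith
    have "((\<lambda>\<delta>. (a * (1 + 4 * \<delta>)) powr \<alpha> * (1 + d * u + \<delta>)) \<longlongrightarrow> (a * (1 + 4 * 0)) powr \<alpha> * (1 + d * u + 0)) (at_right 0)"
      using a by (intro tendsto_intros) auto
    then have "\<forall>\<^sub>F \<delta> in at_right 0. (a * (1 + 4 * \<delta>)) powr \<alpha> * (1 + d * u + \<delta>) < v"
      using uv by (intro order_tendstoD(2)) (auto simp: algebra_simps)
    moreover have "\<forall>\<^sub>F \<delta>::real in at_right 0. \<delta> \<in> {0<..<1}" by (rule eventually_at_right_real) simp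
    ultimately have "\<forall>\<^sub>F \<delta> in at_right 0. (a * (1 + 4 * \<delta>)) powr \<alpha> * (1 + d * u + \<delta>) < v \<and> \<delta> \<in> {0<..<1}"
      by (rule eventually_conj)
    then obtain \<delta> where \<delta>: "0 < \<delta>" "\<delta> < 1" "(a * (1 + 4 * \<delta>)) powr \<alpha> * (1 + d * u + \<delta>) < v"
      by (auto dest!: eventually_happens)
    define l where "l = a * (1 + 4 * \<delta>)"
    have l: "l > 0" using a \<delta> by (simp add: l_def)
    have "\<forall>\<^sub>F x in at_top. tail_R (l * x) \<le> tail_K x + d * tail_R x + \<delta> * tail_K x"
      unfolding a_def l_def by (rule tail_R_upper[OF p \<delta>(1,2) tail_K \<alpha> D])
    moreover have "\<forall>\<^sub>F x in at_top. (1 + d * u + \<delta>) / v * tail_K x \<le> tail_K (l * x)"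
      using \<delta>(3) l v0 by (intro regular_tail_scale_greater[OF tail_K]) (auto simp: l_def powr_minus field_simps)
    ultimately have "\<forall>\<^sub>F x in at_top. tail_R (l * x) / tail_K (l * x) \<le> v"
      using u
    proof eventually_elim
      case (elim x)
      have "d * tail_R x \<le> d * (u * tail_K x)" using elim Vpos[of x] d by (intro mult_left_mono) (auto simp: pos_divide_le_eq)
      then have "tail_R (l * x) \<le> (1 + d * u + \<delta>) * tail_K x" using elim by (simp add: algebra_simps)
      also have "\<dots> \<le> v * tail_K (l * x)" using elim v0 by (simp add: field_simps)
      finally show ?case using Vpos by (simp add: pos_divide_le_eq)
    qed
    then show "\<forall>\<^sub>F x in at_top. tail_R x / tail_K x \<le> v" by (rule eventually_at_top_scale[OF l])
  next
    fix u v assume u0: "0 \<le> u" and u: "\<forall>\<^sub>F x in at_top. u \<le> tail_R x / tail_K x" and uv: "v < a powr \<alpha> + d * a powr \<alpha> * u"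
    show "\<forall>\<^sub>F x in at_top. v \<le> tail_R x / tail_K x"
    proof (cases "v \<le> 0")
      case True
      have "0 \<le> tail_R x / tail_K x" for x using tail_R_nonneg Vpos[of x] by simp
      then show ?thesis using True order_trans by (intro always_eventually) blast
    next
      case False
      have "((\<lambda>\<delta>. (a * (1 - \<delta>)) powr \<alpha> * (1 - \<delta> + (d - 2 * \<delta>) * u)) \<longlongrightarrow> (a * (1 - 0)) powr \<alpha> * (1 - 0 + (d - 2 * 0) * u)) (at_right 0)"
        using a by (intro tendsto_intros) auto
      then have "\<forall>\<^sub>F \<delta> in at_right 0. v < (a * (1 - \<delta>)) powr \<alpha> * (1 - \<delta> + (d - 2 * \<delta>) * u)"
        using uv by (intro order_tendstoD(1)) (auto simp: algebra_simps)
      moreover have "\<forall>\<^sub>F \<delta>::real in at_right 0. \<delta> \<in> {0<..<1/2}" by (rule eventually_at_right_real) simp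
      ultimately have "\<forall>\<^sub>F \<delta> in at_right 0. v < (a * (1 - \<delta>)) powr \<alpha> * (1 - \<delta> + (d - 2 * \<delta>) * u) \<and> \<delta> \<in> {0<..<1/2}"
        by (rule eventually_conj)
      then obtain \<delta> where \<delta>: "0 < \<delta>" "\<delta> < 1 / 2" "v < (a * (1 - \<delta>)) powr \<alpha> * (1 - \<delta> + (d - 2 * \<delta>) * u)"
        by (auto dest!: eventually_happens)
      define l where "l = a * (1 - \<delta>)"
      have l: "l > 0" using a \<delta> by (simp add: l_def)
      have "\<forall>\<^sub>F x in at_top. (1 - \<delta>) * tail_K x + (d - 2 * \<delta>) * tail_R x \<le> tail_R (l * x)"
        unfolding a_def l_def by (rule tail_R_lower[OF p \<delta>(1,2)])
      moreover have "\<forall>\<^sub>F x in at_top. tail_K (l * x) \<le> (1 - \<delta> + (d - 2 * \<delta>) * u) / v * tail_K x"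
      proof (rule regular_tail_scale_less[OF tail_K l])
        define m where "m = 1 - \<delta> + (d - 2 * \<delta>) * u"
        have "v < l powr \<alpha> * m" using \<delta>(3) by (simp add: l_def m_def)
        then have "l powr (- \<alpha>) < m / v" using l False by (simp add: powr_minus field_simps)
        then show "l powr (- \<alpha>) < (1 - \<delta> + (d - 2 * \<delta>) * u) / v" by (simp add: m_def)
      qed
      ultimately have "\<forall>\<^sub>F x in at_top. v \<le> tail_R (l * x) / tail_K (l * x)"
        using u
      proof eventually_elim
        case (elim x)
        have "(d - 2 * \<delta>) * (u * tail_K x) \<le> (d - 2 * \<delta>) * tail_R x"
          using elim Vpos[of x] d \<delta> by (intro mult_left_mono) (auto simp: pos_le_divide_eq)
        then have "(1 - \<delta> + (d - 2 * \<delta>) * u) * tail_K x \<le> tail_R (l * x)" using elim by (simp add: algebra_simps)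
        moreover have "v * tail_K (l * x) \<le> (1 - \<delta> + (d - 2 * \<delta>) * u) * tail_K x" using elim False by (simp add: field_simps)
        ultimately show ?case using Vpos by (simp add: pos_le_divide_eq)
      qed
      then show ?thesis by (rule eventually_at_top_scale[OF l])
    qed
  qed (use a d s1 tail_R_nonneg Vpos in \<open>auto simp: less_imp_le\<close>)
  then show ?thesis by (simp add: a_def)
qed

end

section \<open>Asymptotic equivalence of the tails\<close>

lemma regular_tail_of_asymp_equiv:
  assumes W: "antimono W" and L: "\<forall>x>0. L x > 0" "\<And>t. t > 0 \<Longrightarrow> ((\<lambda>x. L (t * x) / L x) \<longlongrightarrow> 1) at_top"
    and C: "0 < C" and eq: "W \<sim>[at_top] (\<lambda>x. C * (x powr (- \<alpha>) * L x))"
  shows "regular_tail \<alpha> W"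
proof -
  define g where "g x = C * (x powr (- \<alpha>) * L x)" for x
  have g: "g x > 0" if "x > 0" for x using that L C by (simp add: g_def)
  have "((\<lambda>x. if W x = 0 \<and> g x = 0 then 1 else W x / g x) \<longlongrightarrow> 1) at_top"
    using eq unfolding asymp_equiv_def g_def .
  then have lim: "((\<lambda>x. W x / g x) \<longlongrightarrow> 1) at_top"
    by (rule Lim_transform_eventually)
       (use eventually_gt_at_top[of 0] in \<open>eventually_elim, use g in force\<close>)
  have "\<forall>\<^sub>F x in at_top. 0 < W x / g x" using lim by (rule order_tendstoD) simp
  then have "\<forall>\<^sub>F x in at_top. 0 < W x"
    using eventually_gt_at_top[of 0] by eventually_elim (use g in \<open>force simp: zero_less_divide_iff\<close>)
  then obtain N where N: "\<And>x. x \<ge> N \<Longrightarrow> 0 < W x" by (auto simp: eventually_at_top_linorder)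
  have pos: "0 < W x" for x
    using N[of "max x N"] antimonoD[OF W, of x "max x N"] by simp
  have "((\<lambda>x. W (t * x) / W x) \<longlongrightarrow> t powr (- \<alpha>)) at_top" if t: "t > 0" for t
  proof -
    have t_top: "filterlim (\<lambda>x. t * x) at_top at_top"
      by (rule filterlim_tendsto_pos_mult_at_top[OF tendsto_const t filterlim_ident])
    have "((\<lambda>x. W (t * x) / g (t * x)) \<longlongrightarrow> 1) at_top"
      using filterlim_compose[OF lim t_top] .
    then have "((\<lambda>x. W (t * x) / g (t * x) * (t powr (- \<alpha>) * (L (t * x) / L x)) / (W x / g x)) \<longlongrightarrow> 1 * (t powr (- \<alpha>) * 1) / 1) at_top"
      using lim L(2)[OF t] by (intro tendsto_intros) auto
    then have "((\<lambda>x. W (t * x) / g (t * x) * (t powr (- \<alpha>) * (L (t * x) / L x)) / (W x / g x)) \<longlongrightarrow> t powr (- \<alpha>)) at_top" by simp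
    then show ?thesis
    proof (rule Lim_transform_eventually)
      show "\<forall>\<^sub>F x in at_top. W (t * x) / g (t * x) * (t powr (- \<alpha>) * (L (t * x) / L x)) / (W x / g x) = W (t * x) / W x"
        using eventually_gt_at_top[of 0]
      proof eventually_elim
        case (elim x)
        have "L x > 0" "L (t * x) > 0" using L elim t by auto
        then have "t powr (- \<alpha>) * (L (t * x) / L x) = g (t * x) / g x"
          using elim t C by (simp add: g_def powr_mult)
        moreover have "g (t * x) > 0" "g x > 0" using g elim t by auto
        ultimately show ?case using pos[of x] by simp
      qed
    qed
  qed
  then show ?thesis using W pos by (simp add: regular_tail_def)
qed

lemma asymp_equiv_of_ratio:
  fixes f g h :: "real \<Rightarrow> real"
  assumes fg: "((\<lambda>x. f x / g x) \<longlongrightarrow> C) at_top" and C: "C \<noteq> 0" and g: "\<And>x. 0 < g x"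
    and gh: "g \<sim>[at_top] h"
  shows "f \<sim>[at_top] (\<lambda>x. C * h x)"
proof -
  have "f \<sim>[at_top] (\<lambda>x. C * g x)"
  proof (rule asymp_equivI')
    have "((\<lambda>x. f x / g x / C) \<longlongrightarrow> C / C) at_top" using fg C by (intro tendsto_intros)
    then show "((\<lambda>x. f x / (C * g x)) \<longlongrightarrow> 1) at_top" using C by (simp add: mult.commute)
  qed
  also have "(\<lambda>x. C * g x) \<sim>[at_top] (\<lambda>x. C * h x)" using gh by (intro asymp_equiv_intros)
  finally show ?thesis .
qed

lemma tail_df_eq_prob:
  assumes "prob_space M" and [measurable]: "Y \<in> borel_measurable M"
  shows "tail_df M Y x = measure M {\<omega>\<in>space M. x < Y \<omega>}"
proof -
  interpret prob_space M by fact
  have "cdf (distr M borel Y) x = prob {\<omega>\<in>space M. Y \<omega> \<le> x}"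
    by (simp add: cdf_def measure_distr vimage_def Int_def conj_commute)
  moreover have "{\<omega>\<in>space M. x < Y \<omega>} = space M - {\<omega>\<in>space M. Y \<omega> \<le> x}" by auto
  ultimately show ?thesis by (simp add: tail_df_def prob_compl)
qed

lemma indep_rv_prob:
  assumes "prob_space M" and ind: "indep_rv M A X B Y" and "a \<in> sets A" "b \<in> sets B"
  shows "measure M {\<omega>\<in>space M. X \<omega> \<in> a \<and> Y \<omega> \<in> b}
    = measure M {\<omega>\<in>space M. X \<omega> \<in> a} * measure M {\<omega>\<in>space M. Y \<omega> \<in> b}"
proof -
  interpret prob_space M by fact
  have "prob ((X -` a \<inter> space M) \<inter> (Y -` b \<inter> space M)) = prob (X -` a \<inter> space M) * prob (Y -` b \<inter> space M)"
    using ind unfolding indep_rv_def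
    by (intro indep_setD[OF _ in_vimage_algebra[OF assms(3)] in_vimage_algebra[OF assms(4)]]) auto
  moreover have "(X -` a \<inter> space M) \<inter> (Y -` b \<inter> space M) = {\<omega>\<in>space M. X \<omega> \<in> a \<and> Y \<omega> \<in> b}"
    "X -` a \<inter> space M = {\<omega>\<in>space M. X \<omega> \<in> a}" "Y -` b \<inter> space M = {\<omega>\<in>space M. Y \<omega> \<in> b}" by auto
  ultimately show ?thesis by simp
qed

theorem theorem3:
  fixes M :: "'a measure"
    and c \<alpha> :: real and d :: nat and L :: "real \<Rightarrow> real"
    and T R :: "'a \<Rightarrow> real" and N :: "real \<Rightarrow> 'a \<Rightarrow> nat" and Rj :: "nat \<Rightarrow> 'a \<Rightarrow> real"
  assumes "prob_space M"
    and "0 < c" and "c < 1" and "d \<ge> 1"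
    and "\<alpha> > 1" and "\<alpha> \<notin> \<int>"
    and "\<forall>x>0. L x > 0" and "slowly_varying L"
    and "T \<in> borel_measurable M" and "\<forall>\<omega>\<in>space M. 0 \<le> T \<omega>"
    and "integrable M T" and "(\<integral>\<omega>. T \<omega> \<partial>M) = real d"
    and "poisson_process M 1 N"
    and "indep_rv M borel T
           (PiM {0..} (\<lambda>_. count_space UNIV)) (\<lambda>\<omega>. \<lambda>t\<in>{0..}. N t \<omega>)"
    and "R \<in> borel_measurable M" and "\<forall>\<omega>\<in>space M. 0 \<le> R \<omega>"
    and "integrable M R" and "(\<integral>\<omega>. R \<omega> \<partial>M) = 1"
    and "prob_space.indep_vars M (\<lambda>_. borel) Rj {1..}"
    and "\<forall>j\<ge>1. distr M borel (Rj j) = distr M borel R"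
    and "indep_rv M (count_space UNIV) (\<lambda>\<omega>. N (T \<omega>) \<omega>)
           (PiM {1..} (\<lambda>_. borel)) (\<lambda>\<omega>. \<lambda>j\<in>{1..}. Rj j \<omega>)"
    and "distr M borel R =
         distr M borel (\<lambda>\<omega>. c * (\<Sum>j=1..N (T \<omega>) \<omega>. 1 / real d * Rj j \<omega>) + (1 - c))"
  shows "(tail_df M (\<lambda>\<omega>. real (N (T \<omega>) \<omega>)) \<sim>[at_top] (\<lambda>x. x powr (- \<alpha>) * L x))
     \<longleftrightarrow> (tail_df M R \<sim>[at_top]
           (\<lambda>x. c powr \<alpha> / (real d powr \<alpha> - c powr \<alpha> * real d) * (x powr (- \<alpha>) * L x)))"
proof -
  interpret prob_space M by fact
  define K where "K \<omega> = N (T \<omega>) \<omega>" for \<omega>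
  interpret iid_nonneg M R Rj
    by unfold_locales (use assms in auto)
  have K_meas: "K \<in> measurable M (count_space UNIV)"
    using assms(21) unfolding indep_rv_def K_def[abs_def] by blast
  interpret random_sum_fixpoint M R Rj K c "real d"
  proof
    show "K \<in> measurable M (count_space UNIV)" by (rule K_meas)
    show "prob {\<omega>\<in>space M. K \<omega> = k \<and> S k \<omega> \<in> B} = prob {\<omega>\<in>space M. K \<omega> = k} * prob {\<omega>\<in>space M. S k \<omega> \<in> B}"
      if B: "B \<in> sets borel" for k B
    proof -
      define f where "f = (\<lambda>x :: nat \<Rightarrow> real. \<Sum>j=1..k. x j)"
      have f [measurable]: "f \<in> borel_measurable (PiM {1..} (\<lambda>_. borel))"
        unfolding f_def by (intro borel_measurable_sum measurable_component_singleton) auto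
      have fS: "f (\<lambda>j\<in>{1..}. Rj j \<omega>) = S k \<omega>" for \<omega> by (simp add: f_def S_def)
      have sp: "(\<lambda>j\<in>{1..}. Rj j \<omega>) \<in> space (PiM {1..} (\<lambda>_. borel))" for \<omega> by (simp add: space_PiM)
      have "f -` B \<inter> space (PiM {1..} (\<lambda>_. borel)) \<in> sets (PiM {1..} (\<lambda>_. borel))"
        using B by (rule measurable_sets[OF f])
      from indep_rv_prob[OF assms(1) assms(21) _ this, of "{k}"] show ?thesis
        using sp by (simp add: fS[simplified] K_def)
    qed
    show "distr M borel R = distr M borel (\<lambda>\<omega>. c / real d * S (K \<omega>) \<omega> + (1 - c))"
      unfolding assms(22) by (simp add: S_def K_def sum_distrib_left[symmetric] sum_divide_distrib[symmetric])
  qed (use assms in auto)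
  have L: "\<And>t. t > 0 \<Longrightarrow> ((\<lambda>x. L (t * x) / L x) \<longlongrightarrow> 1) at_top"
    using assms(8) by (auto simp: slowly_varying_def)
  have tail_K: "tail_df M (\<lambda>\<omega>. real (N (T \<omega>) \<omega>)) = tail_K"
    using K_meas by (simp add: fun_eq_iff tail_K_def K_def[symmetric] tail_df_eq_prob[OF assms(1)])
  have tail_R: "tail_df M R = tail_R"
    by (simp add: fun_eq_iff tail_R_def tail_df_eq_prob[OF assms(1)])
  define g where "g x = x powr (- \<alpha>) * L x" for x
  define C where "C = c powr \<alpha> / (real d powr \<alpha> - c powr \<alpha> * real d)"
  have cd: "0 < c / real d" "c / real d < 1" using assms(2-4) by auto
  have "(c / real d) powr \<alpha> < (c / real d) powr 1" using cd assms(5) by (intro powr_less_mono') auto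
  then have "real d * (c / real d) powr \<alpha> < real d * (c / real d)" 
    using assms(4) cd by (intro mult_strict_left_mono) auto
  then have s1: "real d * (c / real d) powr \<alpha> < 1" using assms(3,4) by simp
  have C1: "C = (c / real d) powr \<alpha> / (1 - real d * (c / real d) powr \<alpha>)"
    using assms(2-4) by (simp add: C_def powr_divide field_simps)
  have C0: "C > 0" unfolding C1 using s1 cd assms(4) by (intro divide_pos_pos) auto
  have C2: "(c / real d) powr (- \<alpha>) - real d = 1 / C"
  proof -
    define P where "P = (c / real d) powr \<alpha>"
    have "P > 0" using assms(2,4) by (simp add: P_def)
    then show ?thesis unfolding C1 powr_minus P_def[symmetric] by (simp add: field_simps)
  qed
  have "tail_K \<sim>[at_top] g \<longleftrightarrow> tail_R \<sim>[at_top] (\<lambda>x. C * g x)"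
  proof
    assume Vg: "tail_K \<sim>[at_top] g"
    then have reg: "regular_tail \<alpha> tail_K"
      using regular_tail_of_asymp_equiv[of tail_K L 1 \<alpha>] tail_K_antimono assms(7) L
      by (auto simp: g_def[abs_def] antimono_def)
    show "tail_R \<sim>[at_top] (\<lambda>x. C * g x)"
      using C0 ratio_of_regular_tail_K[OF reg assms(5), folded C1] regular_tailD(2)[OF reg] Vg
      by (intro asymp_equiv_of_ratio[of _ tail_K]) auto
  next
    assume qg: "tail_R \<sim>[at_top] (\<lambda>x. C * g x)"
    then have reg: "regular_tail \<alpha> tail_R"
      using regular_tail_of_asymp_equiv[of tail_R L C \<alpha>] tail_R_antimono assms(7) L C0
      by (auto simp: g_def[abs_def] antimono_def)
    have "tail_K \<sim>[at_top] (\<lambda>x. 1 / C * (C * g x))"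
      using C0 regular_tailD(2)[OF reg]
      by (intro asymp_equiv_of_ratio[OF ratio_of_regular_tail_R[OF reg assms(5), unfolded C2] _ _ qg]) auto
    then show "tail_K \<sim>[at_top] g" using C0 by simp
  qed
  then show ?thesis by (simp add: tail_K tail_R g_def[abs_def] C_def)
qed

end
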